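(* Let $\Gamma$ be a dense countable subgroup of $\mathbb{R}$ containing $1$. The following are equivalent: \begin{enumerate} \item $\Gamma$ is finitely generated. \item $D(IE(\Gamma))$ is finitely generated. \item $IE(\Gamma)$ is finitely generated. \end{enumerate}
   Context: $IE(\Gamma)$ is the group, under composition, of all bijections $f:[0,1]\to[0,1]$ with $f(0)=0$ for which there exist $0=x_1<x_2<\dots<x_n=1$ in $\Gamma$ and $c_1,\dots,c_{n-1}\in\Gamma$ with $f(t)=t+c_i$ for all $t\in(x_i,x_{i+1}]$. $D(G)$ denotes the derived (commutator) subgroup of a group $G$. *)

theory Defs
  imports "HOL-Analysis.Analysis" "HOL-Algebra.Bij" "HOL-Algebra.Generated_Groups"
begin

definition fin_gen_group :: "('a, 'b) monoid_scheme \<Rightarrow> bool" where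
  "fin_gen_group G \<longleftrightarrow> (\<exists>S. finite S \<and> S \<subseteq> carrier G \<and> generate G S = carrier G)"

definition real_group :: "real monoid" where
  "real_group = \<lparr>carrier = UNIV, monoid.mult = (+), one = 0\<rparr>"

text \<open>The indices run over \<open>1, \<dots>, n\<close>. The bound \<open>2 \<le> n\<close> excludes \<open>n = 0\<close>, for which
  the conditions on \<open>x\<close> and \<open>c\<close> would say nothing about \<open>f\<close>. Elements of \<open>Bij {0..1}\<close> are
  extensional, so each bijection of the unit interval is represented exactly once.\<close>

definition IE_set :: "real set \<Rightarrow> (real \<Rightarrow> real) set" where
  "IE_set \<Gamma> = {f \<in> Bij {0..1}. f 0 = 0 \<and>
     (\<exists>(n::nat) x c. 2 \<le> n \<and> x 1 = 0 \<and> x n = 1 \<and>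
        (\<forall>i\<in>{1..n}. x i \<in> \<Gamma>) \<and>
        (\<forall>i\<in>{1..<n}. x i < x (Suc i) \<and> c i \<in> \<Gamma> \<and>
           (\<forall>t\<in>{x i<..x (Suc i)}. f t = t + c i)))}"

definition IE :: "real set \<Rightarrow> (real \<Rightarrow> real) monoid" where
  "IE \<Gamma> = (BijGroup {0..1})\<lparr>carrier := IE_set \<Gamma>\<rparr>"

definition derived_group :: "('a, 'b) monoid_scheme \<Rightarrow> ('a, 'b) monoid_scheme" where
  "derived_group G = G\<lparr>carrier := derived G (carrier G)\<rparr>"

end

theory Submission
  imports Defs
begin

text \<open>
  Extending by the identity, view \<open>IE(\<Gamma>)\<close> as a group of permutations of \<open>(0, 1]\<close>.
  It is generated by rotations, which exchange two adjacent intervals. Its derived subgroup is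
  generated by 3-cycles of disjoint translates of an interval: the group of 3-cycles is normal,
  it can move a short interval off another one, so rotations with short support commute modulo it,
  and a 3-cycle is a commutator of two interval swaps.

  Suppose \<open>\<Gamma>\<close> is generated by finitely many small \<open>s\<close>. Finitely many 3-cycles of long windows
  \<open>(X, X + 2d]\<close>, \<open>(X + s, X + s + 2d]\<close>, \<open>\<dots>\<close> suffice to shift every interval of length \<open>d\<close> by any
  \<open>s\<close>, so conjugating a few 3-cycles of length \<open>d\<close> gives all of them. Commutators of two 3-cycles
  whose supports overlap in one place then yield all shorter ones: every short interval
  is the intersection of two translates of \<open>(0, d]\<close>. The rotations exchanging lengths \<open>a\<close> and \<open>b\<close>
  are additive in \<open>a\<close> and \<open>b\<close>, so finitely many of them generate the rest modulo 3-cycles.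
  Conversely, the shifts \<open>f t - t\<close> occurring in a finite set of generators form a finite generating set
  of \<open>\<Gamma>\<close>.
\<close>

text \<open>The boundary of the unit interval shapes most constructions. An interval close to 1
  cannot be shifted by \<open>s\<close>, so a sum of generators of \<Gamma> has to be arranged as a
  walk that stays inside, and this is possible as long as each step is at most half of the room
  available. For this reason two finite generating sets of \<Gamma> occur. Steps between 1/8 and 1/4
  move positions; they must also be at least \<open>2 * d\<close>, so that a window and its
  translate are disjoint. Steps below \<open>d / 2\<close> change the lengths of rotations, which
  range over [0, d]. Density provides generators of any prescribed size. Modulo the 3-cycles, the
  class of a short rotation depends only on the two lengths exchanged, because a 3-cycle carries its
  support to a disjoint place. So finitely many reference positions serve for the rotations as well.
  All intervals are left-open and right-closed, as in the definition of \<open>IE\<close>; shifts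
  are therefore read off at right ends, and breakpoints at the ends of an interval do no
  harm.\<close>

text \<open>The symbol \<open>inv\<close> is taken by the group inverse of HOL-Algebra.\<close>

abbreviation finv :: "(real \<Rightarrow> real) \<Rightarrow> real \<Rightarrow> real" where
  "finv \<equiv> inv_into UNIV"

section \<open>Permutation groups on the real line\<close>

definition real_perms :: "(real \<Rightarrow> real) monoid" where
  "real_perms = \<lparr>carrier = {f. bij f}, monoid.mult = (\<circ>), one = id\<rparr>"

lemma real_perms_simps [simp]:
  "carrier real_perms = {f. bij f}" "f \<otimes>\<^bsub>real_perms\<^esub> g = f \<circ> g" "\<one>\<^bsub>real_perms\<^esub> = id"
  by (simp_all add: real_perms_def)

interpretation real_perms: group real_perms
proof (rule groupI)
  fix f assume "f \<in> carrier real_perms"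
  then have "finv f \<in> carrier real_perms" "finv f \<otimes>\<^bsub>real_perms\<^esub> f = \<one>\<^bsub>real_perms\<^esub>"
    by (auto simp: bij_imp_bij_inv bij_is_inj)
  then show "\<exists>g\<in>carrier real_perms. g \<otimes>\<^bsub>real_perms\<^esub> f = \<one>\<^bsub>real_perms\<^esub>"
    by blast
qed (auto simp: bij_comp comp_assoc)

lemma real_perms_inv [simp]: "bij f \<Longrightarrow> inv\<^bsub>real_perms\<^esub> f = finv f"
  by (rule real_perms.inv_equality) (auto simp: bij_imp_bij_inv bij_is_inj)

abbreviation perm_subgroup :: "(real \<Rightarrow> real) set \<Rightarrow> bool" where
  "perm_subgroup K \<equiv> subgroup K real_perms"

lemma perm_subgroupI:
  assumes "\<And>f. f \<in> K \<Longrightarrow> bij f" "id \<in> K" "\<And>f g. f \<in> K \<Longrightarrow> g \<in> K \<Longrightarrow> f \<circ> g \<in> K"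
    "\<And>f. f \<in> K \<Longrightarrow> finv f \<in> K"
  shows "perm_subgroup K"
  using assms by unfold_locales auto

lemma
  assumes "perm_subgroup K"
  shows perm_bij: "f \<in> K \<Longrightarrow> bij f"
    and perm_id: "id \<in> K"
    and perm_comp: "f \<in> K \<Longrightarrow> g \<in> K \<Longrightarrow> f \<circ> g \<in> K"
    and perm_inv: "f \<in> K \<Longrightarrow> finv f \<in> K"
proof -
  show bij: "f \<in> K \<Longrightarrow> bij f" for f
    using subgroup.subset[OF assms] by auto
  show "id \<in> K" "f \<in> K \<Longrightarrow> g \<in> K \<Longrightarrow> f \<circ> g \<in> K"
    using subgroup.one_closed[OF assms] subgroup.m_closed[OF assms, of f g] by simp_all
  show "f \<in> K \<Longrightarrow> finv f \<in> K"
    using subgroup.m_inv_closed[OF assms, of f] bij[of f] by simp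
qed

lemma perm_conj: "perm_subgroup K \<Longrightarrow> g \<in> K \<Longrightarrow> f \<in> K \<Longrightarrow> g \<circ> f \<circ> finv g \<in> K"
  by (intro perm_comp perm_inv)

lemma comp_inv_cancel:
  assumes "bij g"
  shows "finv g \<circ> g = id" "g \<circ> finv g = id" "finv g \<circ> (g \<circ> h) = h" "g \<circ> (finv g \<circ> h) = h"
  using assms by (auto simp: fun_eq_iff bij_is_inj bij_is_surj surj_f_inv_f)

lemma comp_finv_eqI: "bij h \<Longrightarrow> f = g \<circ> h \<Longrightarrow> f \<circ> finv h = g"
  by (simp add: comp_assoc comp_inv_cancel)

text \<open>Conjugations are established throughout as intertwining relations
  \<open>g \<circ> f = h \<circ> g\<close>, which can be checked pointwise without evaluating an
  inverse.\<close>

lemma conj_eqI: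
  assumes "bij g" "g \<circ> f = h \<circ> g"
  shows "g \<circ> f \<circ> finv g = h" "finv g \<circ> h \<circ> g = f"
  using assms by (simp_all add: comp_inv_cancel comp_assoc) (metis comp_assoc comp_inv_cancel(1,3))+

section \<open>Interval swaps, 3-cycles and rotations\<close>

text \<open>For positive \<open>l\<close> this is disjointness of (x, x + l] and (y, y + l], in a
  form that linear arithmetic can use.\<close>

definition sep :: "real \<Rightarrow> real \<Rightarrow> real \<Rightarrow> bool" where
  "sep l x y \<longleftrightarrow> x + l \<le> y \<or> y + l \<le> x"

definition tcyc :: "real \<Rightarrow> real \<Rightarrow> real \<Rightarrow> real \<Rightarrow> real \<Rightarrow> real" where
  "tcyc x y z l t =
    (if x < t \<and> t \<le> x + l then t - x + y
     else if y < t \<and> t \<le> y + l then t - y + z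
     else if z < t \<and> t \<le> z + l then t - z + x else t)"

definition rot :: "real \<Rightarrow> real \<Rightarrow> real \<Rightarrow> real \<Rightarrow> real" where
  "rot x a b t = (if x < t \<and> t \<le> x + a then t + b
     else if x + a < t \<and> t \<le> x + a + b then t - a else t)"

definition swp :: "real \<Rightarrow> real \<Rightarrow> real \<Rightarrow> real \<Rightarrow> real" where
  "swp x y l t = (if x < t \<and> t \<le> x + l then t - x + y
     else if y < t \<and> t \<le> y + l then t - y + x else t)"

lemma sep_sym: "sep l x y \<longleftrightarrow> sep l y x"
  by (auto simp: sep_def)

lemma sep_mono: "sep l x y \<Longrightarrow> k \<le> l \<Longrightarrow> sep k x y"
  by (auto simp: sep_def)

lemma tcyc_rotate: "sep l x y \<Longrightarrow> sep l y z \<Longrightarrow> sep l x z \<Longrightarrow> tcyc x y z l = tcyc y z x l"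
  by (rule ext) (auto simp: tcyc_def sep_def)

lemma tcyc_comp_reverse:
  assumes "sep l x y" "sep l y z" "sep l x z"
  shows "tcyc x y z l \<circ> tcyc x z y l = id"
proof
  fix t show "(tcyc x y z l \<circ> tcyc x z y l) t = id t"
    using assms unfolding o_def id_def tcyc_def sep_def by (smt (verit))
qed

lemma
  assumes "sep l x y" "sep l y z" "sep l x z"
  shows bij_tcyc: "bij (tcyc x y z l)" and inv_tcyc: "finv (tcyc x y z l) = tcyc x z y l"
proof -
  have "tcyc x y z l \<circ> tcyc x z y l = id" "tcyc x z y l \<circ> tcyc x y z l = id"
    using assms by (auto intro!: tcyc_comp_reverse simp: sep_sym)
  then show "bij (tcyc x y z l)" "finv (tcyc x y z l) = tcyc x z y l"
    by (auto intro: o_bij inv_unique_comp)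
qed

text \<open>Cutting the three intervals at the same offset gives two 3-cycles with disjoint
  supports. This reduces long cycles to short ones, and cycles across breakpoints of a map to cycles
  on which the map is a translation.\<close>

lemma tcyc_split:
  assumes "sep (a + b) x y" "sep (a + b) y z" "sep (a + b) x z" "0 \<le> a" "0 \<le> b"
  shows "tcyc x y z (a + b) = tcyc x y z a \<circ> tcyc (x + a) (y + a) (z + a) b"
proof
  fix t show "tcyc x y z (a + b) t = (tcyc x y z a \<circ> tcyc (x + a) (y + a) (z + a) b) t"
    using assms unfolding o_def tcyc_def sep_def by (smt (verit))
qed

text \<open>Nothing is assumed about \<open>g\<close> outside the three intervals: injectivity
  already keeps the rest of the line out of their images.\<close>

lemma tcyc_conj:
  assumes "bij g" "sep l x y" "sep l y z" "sep l x z"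
    and gx: "\<And>t. x < t \<Longrightarrow> t \<le> x + l \<Longrightarrow> g t = t - x + x'"
    and gy: "\<And>t. y < t \<Longrightarrow> t \<le> y + l \<Longrightarrow> g t = t - y + y'"
    and gz: "\<And>t. z < t \<Longrightarrow> t \<le> z + l \<Longrightarrow> g t = t - z + z'"
  shows "g \<circ> tcyc x y z l = tcyc x' y' z' l \<circ> g"
proof
  fix t
  have inj: "g s = g t \<longleftrightarrow> s = t" for s t
    using assms(1) by (auto dest: bij_is_inj simp: inj_eq)
  have img: "(w' < g t \<and> g t \<le> w' + l) \<longleftrightarrow> (w < t \<and> t \<le> w + l)"
    if "\<And>t. w < t \<Longrightarrow> t \<le> w + l \<Longrightarrow> g t = t - w + w'" for w w' t
  proof
    assume *: "w' < g t \<and> g t \<le> w' + l"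
    then have "g (g t - w' + w) = g t" by (subst that) auto
    then have "g t - w' + w = t" using inj by blast
    then show "w < t \<and> t \<le> w + l" using * by linarith
  qed (use that in auto)
  have img: "(x' < g t \<and> g t \<le> x' + l) \<longleftrightarrow> (x < t \<and> t \<le> x + l)"
    "(y' < g t \<and> g t \<le> y' + l) \<longleftrightarrow> (y < t \<and> t \<le> y + l)"
    "(z' < g t \<and> g t \<le> z' + l) \<longleftrightarrow> (z < t \<and> t \<le> z + l)"
    using gx gy gz by (intro img; blast)+
  show "(g \<circ> tcyc x y z l) t = (tcyc x' y' z' l \<circ> g) t"
  proof -
    consider (1) "x < t \<and> t \<le> x + l" | (2) "y < t \<and> t \<le> y + l" "\<not> (x < t \<and> t \<le> x + l)"
      | (3) "z < t \<and> t \<le> z + l" "\<not> (x < t \<and> t \<le> x + l)" "\<not> (y < t \<and> t \<le> y + l)"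
      | (4) "\<not> (x < t \<and> t \<le> x + l)" "\<not> (y < t \<and> t \<le> y + l)" "\<not> (z < t \<and> t \<le> z + l)"
      using assms(2-4) by blast
    then show ?thesis
    proof cases
      case 1
      then show ?thesis
        unfolding o_def tcyc_def img by (simp add: gx gy)
    next
      case 2
      then show ?thesis
        unfolding o_def tcyc_def img by (auto simp: gy gz)
    next
      case 3
      then show ?thesis
        unfolding o_def tcyc_def img by (auto simp: gx gz)
    next
      case 4
      then show ?thesis
        unfolding o_def tcyc_def img by (simp only: if_False)
    qed
  qed
qed

lemma rot_comp_reverse: "0 \<le> a \<Longrightarrow> 0 \<le> b \<Longrightarrow> rot x a b \<circ> rot x b a = id"
  by (rule ext) (auto simp: rot_def)

lemma
  assumes "0 \<le> a" "0 \<le> b"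
  shows bij_rot: "bij (rot x a b)" and inv_rot: "finv (rot x a b) = rot x b a"
  using rot_comp_reverse[OF assms] rot_comp_reverse[OF assms(2,1)]
  by (auto intro: o_bij inv_unique_comp)

text \<open>The block of length \<open>a'\<close> adjacent to \<open>b\<close> passes
  \<open>b\<close> first, then the block of length \<open>a\<close> does. This is the source of
  additivity in the lengths.\<close>

lemma rot_split_left:
  assumes "0 \<le> a" "0 \<le> a'" "0 \<le> b"
  shows "rot x (a + a') b = rot x a b \<circ> rot (x + a) a' b"
  using assms by (intro ext) (auto simp: rot_def)

lemma rot_split_right:
  assumes "0 \<le> a" "0 \<le> b" "0 \<le> b'"
  shows "rot x a (b + b') = rot (x + b) a b' \<circ> rot x a b"
  using assms by (intro ext) (auto simp: rot_def)

lemma rot_0 [simp]: "rot x 0 b = id" "rot x a 0 = id"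
  by (auto simp: rot_def)

lemma rot_conj:
  assumes "bij g" "0 \<le> a" "0 \<le> b"
    and gx: "\<And>t. x < t \<Longrightarrow> t \<le> x + (a + b) \<Longrightarrow> g t = t - x + x'"
  shows "g \<circ> rot x a b = rot x' a b \<circ> g"
proof
  fix t
  have inj: "g s = g t \<longleftrightarrow> s = t" for s t
    using assms(1) by (auto dest: bij_is_inj simp: inj_eq)
  have outside: "t \<le> x \<or> x + (a + b) < t" if "g t \<le> x' \<or> x' + (a + b) < g t"
    using that gx[of t] by linarith
  have inside: "x < t" "t \<le> x + (a + b)" if *: "x' < g t" "g t \<le> x' + (a + b)"
  proof -
    have "g (g t - x' + x) = g t" using * by (subst gx) auto
    then have "g t - x' + x = t" using inj by blast
    then show "x < t" "t \<le> x + (a + b)" using * by linarith+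
  qed
  show "(g \<circ> rot x a b) t = (rot x' a b \<circ> g) t"
  proof (cases "x < t \<and> t \<le> x + (a + b)")
    case True
    then have "g t = t - x + x'" by (simp add: gx)
    then show ?thesis using True assms(2,3) by (auto simp: rot_def gx)
  next
    case False
    then have "g t \<le> x' \<or> x' + (a + b) < g t" using inside by linarith
    then show ?thesis using False assms(2,3) by (auto simp: rot_def)
  qed
qed

lemma rot_commute:
  assumes "x + a + b \<le> x' \<or> x' + a' + b' \<le> x" "0 \<le> a" "0 \<le> b" "0 \<le> a'" "0 \<le> b'"
  shows "rot x a b \<circ> rot x' a' b' = rot x' a' b' \<circ> rot x a b"
  using assms by (intro ext) (auto simp: rot_def)

lemma swp_involution: "sep l x y \<Longrightarrow> swp x y l \<circ> swp x y l = id"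
  by (rule ext) (auto simp: swp_def sep_def)

lemma
  assumes "sep l x y"
  shows bij_swp: "bij (swp x y l)" and inv_swp: "finv (swp x y l) = swp x y l"
  using swp_involution[OF assms] by (auto intro: o_bij inv_unique_comp)

text \<open>The swaps are involutions, so the product of four factors is their commutator.\<close>

lemma tcyc_eq_commutator:
  assumes "sep l x y" "sep l y z" "sep l x z"
  shows "tcyc x y z l = swp x y l \<circ> swp x z l \<circ> swp x y l \<circ> swp x z l"
proof
  fix t show "tcyc x y z l t = (swp x y l \<circ> swp x z l \<circ> swp x y l \<circ> swp x z l) t"
    using assms unfolding o_def tcyc_def swp_def sep_def by (smt (verit))
qed

text \<open>Says, free of inverses, that the commutator of two 3-cycles whose supports meet only in
  \<open>(x, x + k]\<close> is a 3-cycle of length \<open>k\<close>.\<close>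

lemma tcyc_intersect:
  assumes "0 < k" "k \<le> l" and D: "d = x + k - l" and E: "e' = e + l - k"
    and "sep l x y" "sep l x z" "sep l y z" "sep l d e" "sep l d f" "sep l e f"
    and "sep l x e" "sep l x f" "sep l y d" "sep l z d" "sep l y e" "sep l y f" "sep l z e" "sep l z f"
  shows "tcyc x y z l \<circ> tcyc d e f l = tcyc x y e' k \<circ> (tcyc d e f l \<circ> tcyc x y z l)"
proof
  fix t
  show "(tcyc x y z l \<circ> tcyc d e f l) t = (tcyc x y e' k \<circ> (tcyc d e f l \<circ> tcyc x y z l)) t"
    using assms unfolding o_def tcyc_def sep_def by (smt (verit))
qed

section \<open>Interval exchanges as permutations of the line\<close>

lemma group_real_group: "group real_group"
  by (rule groupI) (auto simp: real_group_def intro: exI[of _ "- _"])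

interpretation real_group: group real_group
  by (rule group_real_group)

lemma real_group_simps [simp]:
  "carrier real_group = UNIV" "x \<otimes>\<^bsub>real_group\<^esub> y = x + y" "\<one>\<^bsub>real_group\<^esub> = 0"
  "inv\<^bsub>real_group\<^esub> x = - x"
proof -
  show *: "carrier real_group = UNIV" "x \<otimes>\<^bsub>real_group\<^esub> y = x + y" "\<one>\<^bsub>real_group\<^esub> = 0" for x y
    by (simp_all add: real_group_def)
  show "inv\<^bsub>real_group\<^esub> x = - x"
    by (rule real_group.inv_equality) (simp_all add: *)
qed

lemma
  assumes "subgroup \<Gamma> real_group"
  shows real_subgroup_zero: "0 \<in> \<Gamma>"
    and real_subgroup_add: "x \<in> \<Gamma> \<Longrightarrow> y \<in> \<Gamma> \<Longrightarrow> x + y \<in> \<Gamma>"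
    and real_subgroup_minus: "x \<in> \<Gamma> \<Longrightarrow> - x \<in> \<Gamma>"
    and real_subgroup_diff: "x \<in> \<Gamma> \<Longrightarrow> y \<in> \<Gamma> \<Longrightarrow> x - y \<in> \<Gamma>"
proof -
  show "0 \<in> \<Gamma>" and add: "x \<in> \<Gamma> \<Longrightarrow> y \<in> \<Gamma> \<Longrightarrow> x + y \<in> \<Gamma>" and minus: "x \<in> \<Gamma> \<Longrightarrow> - x \<in> \<Gamma>" for x y
    using subgroup.one_closed[OF assms] subgroup.m_closed[OF assms, of x y]
      subgroup.m_inv_closed[OF assms, of x] by simp_all
  show "x \<in> \<Gamma> \<Longrightarrow> y \<in> \<Gamma> \<Longrightarrow> x - y \<in> \<Gamma>"
    using add[of x "- y"] minus[of y] by simp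
qed

text \<open>No point of \<open>B\<close> separates \<open>s\<close> from \<open>t\<close>; the cells are the left-open right-closed intervals
  cut out by \<open>B\<close>.\<close>

definition same_cell :: "real set \<Rightarrow> real \<Rightarrow> real \<Rightarrow> bool" where
  "same_cell B s t \<longleftrightarrow> (\<forall>b\<in>B. b < s \<longleftrightarrow> b < t)"

definition piecewise_translation :: "real set \<Rightarrow> (real \<Rightarrow> real) \<Rightarrow> bool" where
  "piecewise_translation B f \<longleftrightarrow> (\<forall>s t. same_cell B s t \<longrightarrow> f s - s = f t - t)"

lemma pwI:
  assumes "\<And>s t. s < t \<Longrightarrow> same_cell B s t \<Longrightarrow> f s - s = f t - t"
  shows "piecewise_translation B f"
  unfolding piecewise_translation_def
proof (intro allI impI)
  fix s t assume *: "same_cell B s t"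
  then have "same_cell B t s" by (auto simp: same_cell_def)
  with * show "f s - s = f t - t"
    using assms[of s t] assms[of t s] by (metis linorder_less_linear)
qed

lemma pwD: "piecewise_translation B f \<Longrightarrow> same_cell B s t \<Longrightarrow> f t = t + (f s - s)"
  by (metis piecewise_translation_def add.commute diff_add_cancel)

lemma same_cell_between: "same_cell B s t \<Longrightarrow> s \<le> u \<Longrightarrow> u \<le> t \<Longrightarrow> same_cell B s u"
  unfolding same_cell_def by (intro ballI, drule (1) bspec) linarith

lemma pw_mono: "piecewise_translation B f \<Longrightarrow> B \<subseteq> C \<Longrightarrow> piecewise_translation C f"
  unfolding piecewise_translation_def same_cell_def by blast

lemma pw_comp:
  assumes "piecewise_translation B f" "piecewise_translation C g"
  shows "piecewise_translation (C \<union> g -` B) (f \<circ> g)"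
proof (rule pwI)
  fix s t assume st: "s < t" "same_cell (C \<union> g -` B) s t"
  then have C: "same_cell C s t" by (auto simp: same_cell_def)
  define c where "c = g s - s"
  have g: "g u = u + c" if "s \<le> u" "u \<le> t" for u
    using pwD[OF assms(2) same_cell_between[OF C that]] by (simp add: c_def)
  have "same_cell B (g s) (g t)"
    unfolding same_cell_def
  proof
    fix b assume b: "b \<in> B"
    show "b < g s \<longleftrightarrow> b < g t"
    proof (rule ccontr)
      assume "\<not> ?thesis"
      then have *: "s \<le> b - c" "b - c < t" using g[of s] g[of t] st(1) by auto
      then have "b - c \<in> g -` B" using g[of "b - c"] b by simp
      then have "b - c < s \<longleftrightarrow> b - c < t" using st(2) by (auto simp: same_cell_def)
      with * show False by simp
    qed
  qed
  from pwD[OF assms(1) this] show "(f \<circ> g) s - s = (f \<circ> g) t - t"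
    using g[of s] g[of t] st(1) by simp
qed

text \<open>If a breakpoint lay between the preimages, take the least one: up to it \<open>f\<close>
  is a single translation, so its image lies in [s, t) and separates \<open>s\<close> from
  \<open>t\<close>. Finiteness of \<open>B\<close> provides the least one.\<close>

lemma pw_finv:
  assumes "piecewise_translation B f" "bij f" "finite B"
  shows "piecewise_translation (f ` B) (finv f)"
proof (rule pwI)
  fix s t assume st: "s < t" "same_cell (f ` B) s t"
  define s' where "s' = finv f s"
  have s': "f s' = s" using assms(2) by (simp add: s'_def bij_is_surj surj_f_inv_f)
  have "same_cell B s' (s' + (t - s))"
  proof (rule ccontr)
    assume "\<not> ?thesis"
    then have ne: "{b \<in> B. s' \<le> b \<and> b < s' + (t - s)} \<noteq> {}"
      using st(1) by (auto simp: same_cell_def)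
    define b where "b = Min {b \<in> B. s' \<le> b \<and> b < s' + (t - s)}"
    have b: "b \<in> B" "s' \<le> b" "b < s' + (t - s)"
      using Min_in[OF _ ne] assms(3) by (auto simp: b_def)
    have "b \<le> b'" if "b' \<in> B" "s' \<le> b'" "b' < s' + (t - s)" for b'
      unfolding b_def using that assms(3) by (intro Min_le) auto
    then have "same_cell B s' b" using b by (force simp: same_cell_def)
    from pwD[OF assms(1) this] have "f b = b + (s - s')" using s' by simp
    with b st(2) show False by (force simp: same_cell_def)
  qed
  from pwD[OF assms(1) this] have "f (s' + (t - s)) = t" using s' by simp
  then have "finv f t = s' + (t - s)" using assms(2) by (metis bij_inv_eq_iff)
  then show "finv f s - s = finv f t - t" by (simp add: s'_def)
qed

text \<open>Breakpoints are only asked to lie in some finite subset of \<Gamma>, not to be the exact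
  discontinuities; composites and inverses may then use any convenient set.\<close>

definition iet :: "real set \<Rightarrow> (real \<Rightarrow> real) set" where
  "iet \<Gamma> = {f. f permutes {0<..1} \<and> (\<forall>t. f t - t \<in> \<Gamma>) \<and> (\<exists>B. finite B \<and> B \<subseteq> \<Gamma> \<and> piecewise_translation B f)}"

lemma permutes_bijI: "bij f \<Longrightarrow> (\<And>t. t \<notin> S \<Longrightarrow> f t = t) \<Longrightarrow> f permutes S"
  unfolding permutes_def by (metis bij_pointE)

lemma iet_subgroup:
  assumes \<Gamma>: "subgroup \<Gamma> real_group"
  shows "perm_subgroup (iet \<Gamma>)"
proof (rule perm_subgroupI)
  show "id \<in> iet \<Gamma>"
    using real_subgroup_zero[OF \<Gamma>] by (auto simp: iet_def piecewise_translation_def permutes_id intro!: exI[of _ "{}"])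
next
  fix f g assume f: "f \<in> iet \<Gamma>" and g: "g \<in> iet \<Gamma>"
  from f obtain B where B: "finite B" "B \<subseteq> \<Gamma>" "piecewise_translation B f" by (auto simp: iet_def)
  from g obtain C where C: "finite C" "C \<subseteq> \<Gamma>" "piecewise_translation C g" by (auto simp: iet_def)
  have "inj g" using g by (auto simp: iet_def permutes_inj)
  then have "finite (C \<union> g -` B)" using B C by (auto intro: finite_vimageI)
  moreover have "g -` B \<subseteq> \<Gamma>"
  proof
    fix t assume "t \<in> g -` B"
    then have "g t \<in> \<Gamma>" "g t - t \<in> \<Gamma>" using B g by (auto simp: iet_def)
    from real_subgroup_diff[OF \<Gamma> this] show "t \<in> \<Gamma>" by simp
  qed
  moreover have "(f \<circ> g) t - t \<in> \<Gamma>" for t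
    using real_subgroup_add[OF \<Gamma>, of "f (g t) - g t" "g t - t"] f g by (auto simp: iet_def)
  ultimately show "f \<circ> g \<in> iet \<Gamma>"
    using f g pw_comp[OF B(3) C(3)] C(2) by (auto simp: iet_def intro!: permutes_compose exI[of _ "C \<union> g -` B"])
next
  fix f assume f: "f \<in> iet \<Gamma>"
  then show bij: "bij f" by (auto simp: iet_def permutes_bij)
  from f obtain B where B: "finite B" "B \<subseteq> \<Gamma>" "piecewise_translation B f" by (auto simp: iet_def)
  have "f ` B \<subseteq> \<Gamma>"
  proof
    fix t assume "t \<in> f ` B"
    then obtain b where b: "b \<in> \<Gamma>" "t = f b" using B by auto
    have "f b - b \<in> \<Gamma>" using f by (auto simp: iet_def)
    from real_subgroup_add[OF \<Gamma> this b(1)] show "t \<in> \<Gamma>" using b by simp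
  qed
  moreover have "finv f t - t \<in> \<Gamma>" for t
  proof -
    have "f (finv f t) - finv f t \<in> \<Gamma>" using f by (simp add: iet_def)
    from real_subgroup_minus[OF \<Gamma> this] show ?thesis
      using bij by (simp add: bij_is_surj surj_f_inv_f)
  qed
  ultimately show "finv f \<in> iet \<Gamma>"
    using f B pw_finv[OF B(3) bij B(1)]
    by (auto simp: iet_def permutes_inv intro!: exI[of _ "f ` B"])
qed

section \<open>Rotations generate all interval exchanges\<close>

definition inside :: "real set \<Rightarrow> real \<Rightarrow> real \<Rightarrow> bool" where
  "inside \<Gamma> l x \<longleftrightarrow> x \<in> \<Gamma> \<and> 0 \<le> x \<and> x + l \<le> 1"

lemma rot_in_iet:
  assumes \<Gamma>: "subgroup \<Gamma> real_group" and "a \<in> \<Gamma>" "b \<in> \<Gamma>" "inside \<Gamma> (a + b) x" "0 \<le> a" "0 \<le> b"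
  shows "rot x a b \<in> iet \<Gamma>"
proof -
  have "rot x a b permutes {0<..1}"
    using assms by (intro permutes_bijI bij_rot) (auto simp: rot_def inside_def)
  moreover have "rot x a b t - t \<in> \<Gamma>" for t
    using assms real_subgroup_minus[OF \<Gamma>] real_subgroup_zero[OF \<Gamma>] by (auto simp: rot_def)
  moreover have "piecewise_translation {x, x + a, x + a + b} (rot x a b)"
    by (auto simp: piecewise_translation_def same_cell_def rot_def not_less[symmetric])
  moreover have "{x, x + a, x + a + b} \<subseteq> \<Gamma>"
    using assms by (auto simp: inside_def intro!: real_subgroup_add[OF \<Gamma>])
  ultimately show ?thesis by (auto simp: iet_def intro!: exI[of _ "{x, x + a, x + a + b}"])
qed

lemma swp_in_iet:
  assumes \<Gamma>: "subgroup \<Gamma> real_group" and "l \<in> \<Gamma>" "inside \<Gamma> l x" "inside \<Gamma> l y" "sep l x y"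
  shows "swp x y l \<in> iet \<Gamma>"
proof -
  have "swp x y l permutes {0<..1}"
    using assms by (intro permutes_bijI bij_swp) (auto simp: swp_def inside_def)
  moreover have "swp x y l t - t \<in> \<Gamma>" for t
    using assms real_subgroup_diff[OF \<Gamma>] real_subgroup_zero[OF \<Gamma>]
    by (auto simp: swp_def inside_def)
  moreover have "piecewise_translation {x, x + l, y, y + l} (swp x y l)"
    by (auto simp: piecewise_translation_def same_cell_def swp_def not_less[symmetric])
  moreover have "{x, x + l, y, y + l} \<subseteq> \<Gamma>"
    using assms by (auto simp: inside_def intro!: real_subgroup_add[OF \<Gamma>])
  ultimately show ?thesis by (auto simp: iet_def intro!: exI[of _ "{x, x + l, y, y + l}"])
qed

text \<open>Rotating the first cell back to its place makes the map the identity on that cell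
  without creating new breakpoints above it.\<close>

lemma iet_in_rot_subgroup_aux:
  fixes f :: "real \<Rightarrow> real"
  assumes \<Gamma>: "subgroup \<Gamma> real_group" and K: "perm_subgroup K"
    and rot: "\<And>x a b. a \<in> \<Gamma> \<Longrightarrow> b \<in> \<Gamma> \<Longrightarrow> 0 < a \<Longrightarrow> 0 < b \<Longrightarrow> inside \<Gamma> (a + b) x \<Longrightarrow> rot x a b \<in> K"
    and B: "finite B" "B \<subseteq> \<Gamma>" "1 \<in> B"
    and "p \<in> \<Gamma>" "0 \<le> p" "p < 1" "bij f" "\<And>t. t \<le> p \<or> 1 < t \<Longrightarrow> f t = t"
      "\<And>t. f t - t \<in> \<Gamma>" "piecewise_translation B f"
  shows "f \<in> K"
  using assms(7-)
proof (induction "card {b \<in> B. p < b}" arbitrary: p f rule: less_induct)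
  case less
  note fx = less.prems(5) and pwf = less.prems(7)
  have inj: "f s = f t \<longleftrightarrow> s = t" for s t
    using less.prems(4) by (auto dest: bij_is_inj simp: inj_eq)
  define b where "b = Min {b \<in> B. p < b}"
  have ne: "1 \<in> {b \<in> B. p < b}" and fin: "finite {b \<in> B. p < b}" using B less.prems by auto
  then have b: "b \<in> B" "p < b" "b \<le> 1"
    using Min_in[OF fin] Min_le[OF fin ne] ne unfolding b_def by blast+
  have bmin: "b \<le> b'" if "b' \<in> B" "p < b'" for b'
    unfolding b_def using that fin by (intro Min_le) auto
  define c where "c = f b - b"
  have c\<Gamma>: "c \<in> \<Gamma>" using less.prems(6) by (simp add: c_def)
  have first: "f t = t + c" if "p < t" "t \<le> b" for t
  proof -
    have "same_cell B b t" using that bmin by (force simp: same_cell_def)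
    from pwD[OF pwf this] show ?thesis by (simp add: c_def)
  qed
  have range: "p < f t" "f t \<le> 1" if "p < t" "t \<le> 1" for t
    using fx[of "f t"] inj[of "f t" t] that by force+
  have "0 \<le> c"
  proof (rule ccontr)
    assume "\<not> 0 \<le> c"
    \<comment> \<open>If \<open>c\<close> were negative, this point of the first cell would be sent
      to \<open>p\<close> or below, where all values are already taken by fixed points.\<close>
    then have "p < min b (p - c)" "min b (p - c) \<le> 1" using b by auto
    with range(1)[OF this] first[of "min b (p - c)"] show False by (auto simp: min_def split: if_splits)
  qed
  have "b + c \<le> 1" using range(2)[of b] first[of b] b by simp
  have b\<Gamma>: "b \<in> \<Gamma>" "b - p \<in> \<Gamma>"
    using b B less.prems(1) real_subgroup_diff[OF \<Gamma>, of b p] by auto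
  \<comment> \<open>\<open>f\<close> carries (p, b] to (p + c, b + c]; \<open>r\<close> exchanges
    this image with the gap (p, p + c] in front of it and so brings it back.\<close>
  define r where "r = rot p c (b - p)"
  have "r \<in> K"
  proof (cases "c = 0")
    case True then show ?thesis using perm_id[OF K] by (simp only: r_def rot_0)
  next
    case False
    then show ?thesis
      unfolding r_def using \<open>0 \<le> c\<close> b b\<Gamma> c\<Gamma> \<open>b + c \<le> 1\<close> less.prems
      by (intro rot) (auto simp: inside_def)
  qed
  have bijr: "bij r" using \<open>r \<in> K\<close> perm_bij[OF K] by blast
  define g where "g = r \<circ> f"
  have g_id: "g t = t" if t: "t \<le> b \<or> 1 < t" for t
  proof -
    consider "t \<le> p" | "p < t" "t \<le> b" | "1 < t" using t by linarith
    then show ?thesis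
      using fx first \<open>0 \<le> c\<close> \<open>b + c \<le> 1\<close> b less.prems by cases (auto simp: g_def r_def rot_def)
  qed
  have bijg: "bij g" using less.prems(4) bijr by (auto simp: g_def bij_comp)
  have g\<Gamma>: "g t - t \<in> \<Gamma>" for t
  proof -
    have "r (f t) - f t \<in> \<Gamma>"
      using c\<Gamma> b\<Gamma> real_subgroup_minus[OF \<Gamma>] real_subgroup_zero[OF \<Gamma>] by (auto simp: r_def rot_def)
    from real_subgroup_add[OF \<Gamma> this less.prems(6)[of t]] show ?thesis by (simp add: g_def)
  qed
  have pwg: "piecewise_translation B g"
  proof (rule pwI)
    fix s t assume st: "s < t" "same_cell B s t"
    show "g s - s = g t - t"
    proof (cases "s \<le> b")
      case True
      then have "t \<le> b" using st b by (force simp: same_cell_def)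
      then show ?thesis using True g_id by simp
    next
      case False
      have f: "f u = u + (f s - s)" if "s \<le> u" "u \<le> t" for u
        using pwD[OF pwf same_cell_between[OF st(2) that]] .
      have outside: "f u \<le> p + c \<or> b + c < f u" if "b < u" for u
      proof (rule ccontr)
        assume n: "\<not> ?thesis"
        then have "f (f u - c) = f u" by (subst first) auto
        then show False using inj[of "f u - c" u] that n by linarith
      qed
      have gt: "p < f u" if "b < u" for u
      proof (rule ccontr)
        assume n: "\<not> ?thesis"
        then have "f u = u" using fx[of "f u"] inj[of "f u" u] by auto
        then show False using that b n by linarith
      qed
      \<comment> \<open>The image of a cell above \<open>b\<close> cannot jump across the block (p +
        c, b + c]: an intermediate point \<open>u\<close> would be sent to \<open>b + c\<close>,
        which is already the value at \<open>b\<close>. Hence \<open>r\<close> shifts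
        \<open>f s\<close> and \<open>f t\<close> by the same amount.\<close>
      have "\<not> (f s \<le> p + c \<and> b + c < f t)"
      proof
        assume *: "f s \<le> p + c \<and> b + c < f t"
        define u where "u = b + c - (f s - s)"
        have "s \<le> u" "u \<le> t" using * f[of t] st(1) b by (auto simp: u_def)
        then have "f u = f b" using f[of u] first[of b] b by (simp add: u_def)
        then show False using inj[of u b] False \<open>s \<le> u\<close> by simp
      qed
      then have "(f s \<le> p + c \<and> f t \<le> p + c) \<or> (b + c < f s \<and> b + c < f t)"
        using outside[of s] outside[of t] f[of t] st(1) False by linarith
      moreover have "p < f s" "p < f t" using gt[of s] gt[of t] st(1) False by auto
      ultimately show ?thesis
        using f[of t] st(1) b by (auto simp: g_def r_def rot_def)
    qed
  qed
  have "g \<in> K"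
  proof (cases "b = 1")
    case True
    then have "g = id" using g_id by (force simp: fun_eq_iff)
    then show ?thesis using perm_id[OF K] by simp
  next
    case False
    have "{b' \<in> B. b < b'} \<subset> {b' \<in> B. p < b'}" using b by auto
    from psubset_card_mono[OF fin this] show ?thesis
      using less.hyps[of b g] b b\<Gamma> False bijg g_id g\<Gamma> pwg less.prems by auto
  qed
  then have "finv r \<circ> g \<in> K" using perm_comp[OF K perm_inv[OF K \<open>r \<in> K\<close>]] by simp
  then show ?case by (simp add: g_def comp_inv_cancel[OF bijr])
qed

lemma iet_subset_if_rots:
  assumes \<Gamma>: "subgroup \<Gamma> real_group" and "1 \<in> \<Gamma>" and K: "perm_subgroup K"
    and rot: "\<And>x a b. a \<in> \<Gamma> \<Longrightarrow> b \<in> \<Gamma> \<Longrightarrow> 0 < a \<Longrightarrow> 0 < b \<Longrightarrow> inside \<Gamma> (a + b) x \<Longrightarrow> rot x a b \<in> K"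
  shows "iet \<Gamma> \<subseteq> K"
proof
  fix f assume f: "f \<in> iet \<Gamma>"
  then obtain B where B: "finite B" "B \<subseteq> \<Gamma>" "piecewise_translation B f" by (auto simp: iet_def)
  show "f \<in> K"
  \<comment> \<open>Adding 1 to the breakpoints ensures that a least breakpoint above the current
    fixed part always exists and is at most 1.\<close>
  proof (rule iet_in_rot_subgroup_aux[OF \<Gamma> K rot, where B = "insert 1 B" and p = 0])
    show "f t = t" if "t \<le> 0 \<or> 1 < t" for t
      using f that by (auto simp: iet_def intro: permutes_not_in)
    show "piecewise_translation (insert 1 B) f" using B(3) by (rule pw_mono) auto
  qed (use f B assms real_subgroup_zero[OF \<Gamma>] in \<open>auto simp: iet_def permutes_bij\<close>)
qed

text \<open>Pieces of length \<open>d\<close> are split off from \<open>a\<close> while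
  \<open>b\<close> is short, and then from \<open>b\<close>; the second induction uses the first for
  each piece of \<open>b\<close>, with \<open>a\<close> arbitrary.\<close>

lemma iet_subset_if_small_rots:
  assumes \<Gamma>: "subgroup \<Gamma> real_group" and "1 \<in> \<Gamma>" and K: "perm_subgroup K" and d: "d \<in> \<Gamma>" "0 < d"
    and rot: "\<And>x a b. a \<in> \<Gamma> \<Longrightarrow> b \<in> \<Gamma> \<Longrightarrow> 0 \<le> a \<Longrightarrow> a \<le> d \<Longrightarrow> 0 \<le> b \<Longrightarrow> b \<le> d \<Longrightarrow>
      inside \<Gamma> (a + b) x \<Longrightarrow> rot x a b \<in> K"
  shows "iet \<Gamma> \<subseteq> K"
proof -
  have left: "rot x a b \<in> K"
    if "a \<le> real n * d" "a \<in> \<Gamma>" "b \<in> \<Gamma>" "0 \<le> a" "0 \<le> b" "b \<le> d" "inside \<Gamma> (a + b) x" for n x a b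
    using that
  proof (induction n arbitrary: x a)
    case 0
    then have "a = 0" by simp
    then show ?case using perm_id[OF K] by (simp only: rot_0)
  next
    case (Suc n)
    show ?case
    proof (cases "a \<le> d")
      case True
      then show ?thesis using rot Suc.prems by blast
    next
      case False
      then have "rot (x + d) (a - d) b \<in> K"
        using Suc.prems d by (intro Suc.IH) (auto simp: inside_def algebra_simps intro: real_subgroup_diff[OF \<Gamma>] real_subgroup_add[OF \<Gamma>])
      moreover have "rot x d b \<in> K"
        using Suc.prems d False by (intro rot) (auto simp: inside_def)
      moreover have "rot x a b = rot x d b \<circ> rot (x + d) (a - d) b"
        using rot_split_left[of d "a - d" b x] Suc.prems d False by simp
      ultimately show ?thesis using perm_comp[OF K] by metis
    qed
  qed
  have "rot x a b \<in> K"
    if "b \<le> real n * d" "a \<in> \<Gamma>" "b \<in> \<Gamma>" "0 \<le> a" "0 \<le> b" "inside \<Gamma> (a + b) x" for n x a b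
    using that
  proof (induction n arbitrary: x b)
    case 0
    then have "b = 0" by simp
    then show ?case using perm_id[OF K] by (simp only: rot_0)
  next
    case (Suc n)
    obtain m where "a / d \<le> real m" using real_arch_simple by blast
    then have m: "a \<le> real m * d" using d by (simp add: field_simps)
    show ?case
    proof (cases "b \<le> d")
      case True
      then show ?thesis using left[OF m] Suc.prems by blast
    next
      case False
      then have "rot (x + d) a (b - d) \<in> K"
        using Suc.prems d by (intro Suc.IH) (auto simp: inside_def algebra_simps intro: real_subgroup_diff[OF \<Gamma>] real_subgroup_add[OF \<Gamma>])
      moreover have "rot x a d \<in> K"
        using Suc.prems d False by (intro left[OF m]) (auto simp: inside_def)
      moreover have "rot x a b = rot (x + d) a (b - d) \<circ> rot x a d"
        using rot_split_right[of a d "b - d" x] Suc.prems d False by simp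
      ultimately show ?thesis using perm_comp[OF K] by metis
    qed
  qed
  note right = this
  show ?thesis
  proof (rule iet_subset_if_rots[OF \<Gamma> \<open>1 \<in> \<Gamma>\<close> K])
    fix x a b :: real assume *: "a \<in> \<Gamma>" "b \<in> \<Gamma>" "0 < a" "0 < b" "inside \<Gamma> (a + b) x"
    obtain m where "b / d \<le> real m" using real_arch_simple by blast
    then have "b \<le> real m * d" using d by (simp add: field_simps)
    from right[OF this] * show "rot x a b \<in> K" by simp
  qed
qed

section \<open>The group generated by the 3-cycles\<close>

definition triple :: "real set \<Rightarrow> real \<Rightarrow> real \<Rightarrow> real \<Rightarrow> real \<Rightarrow> bool" where
  "triple \<Gamma> l x y z \<longleftrightarrow> l \<in> \<Gamma> \<and> 0 < l \<and> inside \<Gamma> l x \<and> inside \<Gamma> l y \<and> inside \<Gamma> l z \<and>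
     sep l x y \<and> sep l y z \<and> sep l x z"

definition tcycs :: "real set \<Rightarrow> (real \<Rightarrow> real) set" where
  "tcycs \<Gamma> = {tcyc x y z l | x y z l. triple \<Gamma> l x y z}"

definition cyc_group :: "real set \<Rightarrow> (real \<Rightarrow> real) set" where
  "cyc_group \<Gamma> = generate real_perms (tcycs \<Gamma>)"

lemma triple_bij: "triple \<Gamma> l x y z \<Longrightarrow> bij (tcyc x y z l)"
  by (auto simp: triple_def intro: bij_tcyc)

lemma cyc_group_subgroup: "perm_subgroup (cyc_group \<Gamma>)"
  unfolding cyc_group_def
  by (rule real_perms.generate_is_subgroup) (auto simp: tcycs_def triple_bij)

lemma tcyc_in_cyc_group: "triple \<Gamma> l x y z \<Longrightarrow> tcyc x y z l \<in> cyc_group \<Gamma>"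
  unfolding cyc_group_def by (rule generate.incl) (auto simp: tcycs_def)

lemma perm_comm_closed:
  assumes K: "perm_subgroup K" and "f \<in> K" "g \<in> K"
  shows "f \<circ> g \<circ> finv f \<circ> finv g \<in> K"
  using assms by (intro perm_comp[OF K] perm_inv[OF K])

lemma tcyc_in_iet:
  assumes \<Gamma>: "subgroup \<Gamma> real_group" and t: "triple \<Gamma> l x y z"
  shows "tcyc x y z l \<in> iet \<Gamma>"
proof -
  have "tcyc x y z l = swp x y l \<circ> swp x z l \<circ> finv (swp x y l) \<circ> finv (swp x z l)"
    using t by (simp add: triple_def tcyc_eq_commutator inv_swp del: fun.map_comp)
  moreover have "swp x y l \<in> iet \<Gamma>" "swp x z l \<in> iet \<Gamma>"
    using t by (auto simp: triple_def intro!: swp_in_iet[OF \<Gamma>])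
  ultimately show ?thesis
    using perm_comm_closed[OF iet_subgroup[OF \<Gamma>]] by metis
qed

lemma cyc_group_subset_iet:
  assumes \<Gamma>: "subgroup \<Gamma> real_group"
  shows "cyc_group \<Gamma> \<subseteq> iet \<Gamma>"
  unfolding cyc_group_def
  by (rule real_perms.generate_subgroup_incl[OF _ iet_subgroup[OF \<Gamma>]])
     (auto simp: tcycs_def tcyc_in_iet[OF \<Gamma>])

lemma triple_split:
  assumes \<Gamma>: "subgroup \<Gamma> real_group" and t: "triple \<Gamma> l x y z" and "a \<in> \<Gamma>" "0 < a" "a < l"
  shows "triple \<Gamma> a x y z" "triple \<Gamma> (l - a) (x + a) (y + a) (z + a)"
    "tcyc x y z l = tcyc x y z a \<circ> tcyc (x + a) (y + a) (z + a) (l - a)"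
proof -
  show "triple \<Gamma> a x y z" "triple \<Gamma> (l - a) (x + a) (y + a) (z + a)"
  proof -
    have sep: "sep a u v \<and> sep (l - a) (u + a) (v + a)" if "sep l u v" for u v
      using that assms(4,5) by (simp add: sep_def) linarith
    have inside: "inside \<Gamma> a u \<and> inside \<Gamma> (l - a) (u + a)" if "inside \<Gamma> l u" for u
      using that assms(3-5) real_subgroup_add[OF \<Gamma>, of u a] by (simp add: inside_def)
    show "triple \<Gamma> a x y z" "triple \<Gamma> (l - a) (x + a) (y + a) (z + a)"
      using t assms(3-5) real_subgroup_diff[OF \<Gamma>, of l a] by (simp_all add: triple_def sep inside)
  qed
  show "tcyc x y z l = tcyc x y z a \<circ> tcyc (x + a) (y + a) (z + a) (l - a)"
    using tcyc_split[of a "l - a" x y z] assms by (simp add: triple_def)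
qed

section \<open>Normality of the group of 3-cycles\<close>

lemma sep_image:
  assumes inj: "inj g" and "sep l x y" "0 < l"
    and gx: "\<And>t. x < t \<Longrightarrow> t \<le> x + l \<Longrightarrow> g t = t - x + x'"
    and gy: "\<And>t. y < t \<Longrightarrow> t \<le> y + l \<Longrightarrow> g t = t - y + y'"
  shows "sep l x' y'"
proof (rule ccontr)
  assume n: "\<not> ?thesis"
  \<comment> \<open>If the images overlapped, the right end of the one further left would lie in
    both.\<close>
  define w where "w = min x' y' + l"
  have "x' < w" "w \<le> x' + l" "y' < w" "w \<le> y' + l"
    using n \<open>0 < l\<close> by (auto simp: w_def sep_def min_def not_le)
  then have "g (w - x' + x) = g (w - y' + y)"
    by (subst gx, simp_all add: gy)
  then have "w - x' + x = w - y' + y" by (rule injD[OF inj])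
  then show False
    using \<open>sep l x y\<close> \<open>x' < w\<close> \<open>w \<le> x' + l\<close> \<open>y' < w\<close> \<open>w \<le> y' + l\<close>
    unfolding sep_def by linarith
qed

lemma inside_image:
  assumes \<Gamma>: "subgroup \<Gamma> real_group" and f: "f \<in> iet \<Gamma>" and "inside \<Gamma> l x" "0 < l"
    and fx: "\<And>t. x < t \<Longrightarrow> t \<le> x + l \<Longrightarrow> f t = t - x + x'"
  shows "inside \<Gamma> l x'"
proof -
  have range: "0 < f t \<and> f t \<le> 1" if "0 < t" "t \<le> 1" for t
    using that f permutes_in_image[of f "{0<..1}" t] by (simp add: iet_def)
  have "f (x + l) - (x + l) \<in> \<Gamma>" using f by (simp add: iet_def)
  then have "x' \<in> \<Gamma>"
    using fx[of "x + l"] assms real_subgroup_add[OF \<Gamma>, of "x' - x" x] by (simp add: inside_def)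
  moreover have "x' + l \<le> 1"
    using fx[of "x + l"] range[of "x + l"] assms by (simp add: inside_def)
  moreover have "0 \<le> x'"
  proof (rule ccontr)
    assume n: "\<not> ?thesis"
    \<comment> \<open>The left end itself does not belong to the interval, so the contradiction
      needs a point just above it whose image is not positive; the minimum keeps it within length
      \<open>l\<close>.\<close>
    define t where "t = x + min l (- x')"
    have "x < t" "t \<le> x + l" "0 < t" "t \<le> 1" "t - x + x' \<le> 0"
      using n assms by (auto simp: t_def inside_def)
    with fx[of t] range[of t] show False by simp
  qed
  ultimately show ?thesis by (simp add: inside_def)
qed

text \<open>If \<open>f\<close> is a translation on each of the three intervals, the conjugate is
  again a 3-cycle. Otherwise all three are cut at the offset of a breakpoint inside one of them, and
  both halves have fewer interior breakpoints in total.\<close>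

lemma cyc_group_conj_tcyc:
  assumes \<Gamma>: "subgroup \<Gamma> real_group" and f: "f \<in> iet \<Gamma>" and t: "triple \<Gamma> l x y z"
  shows "f \<circ> tcyc x y z l \<circ> finv f \<in> cyc_group \<Gamma>"
proof -
  from f obtain B where B: "finite B" "B \<subseteq> \<Gamma>" "piecewise_translation B f" by (auto simp: iet_def)
  have bij: "bij f" using f by (auto simp: iet_def permutes_bij)
  \<comment> \<open>Only breakpoints in the open interval count: one at either end does not separate
    points of (x, x + l].\<close>
  define N where "N x l = card (B \<inter> {x<..<x + l})" for x l
  have N_mono: "N u k \<le> N x l" if "x \<le> u" "u + k \<le> x + l" for u k x l
    unfolding N_def using that B by (intro card_mono) auto
  have N_less: "N u k < N x l" if "x \<le> u" "u + k \<le> x + l" "b \<in> B" "x < b" "b < x + l" "b \<le> u \<or> u + k \<le> b"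
    for u k x l b
  proof -
    have "B \<inter> {u<..<u + k} \<subseteq> B \<inter> {x<..<x + l}" "b \<in> B \<inter> {x<..<x + l}" "b \<notin> B \<inter> {u<..<u + k}"
      using that by auto
    then show ?thesis unfolding N_def using B by (intro psubset_card_mono) blast+
  qed
  show ?thesis
    using t
  proof (induction "N x l + N y l + N z l" arbitrary: x y z l rule: less_induct)
    case less
    note t = less.prems
    show ?case
    proof (cases "B \<inter> {x<..<x + l} = {} \<and> B \<inter> {y<..<y + l} = {} \<and> B \<inter> {z<..<z + l} = {}")
      case True
      have shift: "f t = t - w + (f (w + l) - l)"
        if "B \<inter> {w<..<w + l} = {}" "w < t" "t \<le> w + l" for w t
      proof -
        have "same_cell B (w + l) t"
          unfolding same_cell_def
        proof
          fix b assume "b \<in> B"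
          then have "\<not> (w < b \<and> b < w + l)" using that(1) by auto
          then show "b < w + l \<longleftrightarrow> b < t" using that(2,3) by linarith
        qed
        from pwD[OF B(3) this] show ?thesis by simp
      qed
      define x' y' z' where "x' = f (x + l) - l" "y' = f (y + l) - l" "z' = f (z + l) - l"
      have fx: "f t = t - x + x'" if "x < t" "t \<le> x + l" for t
        using shift[OF _ that] True by (simp add: x'_y'_z'_def)
      have fy: "f t = t - y + y'" if "y < t" "t \<le> y + l" for t
        using shift[OF _ that] True by (simp add: x'_y'_z'_def)
      have fz: "f t = t - z + z'" if "z < t" "t \<le> z + l" for t
        using shift[OF _ that] True by (simp add: x'_y'_z'_def)
      have "sep l x' y'" "sep l y' z'" "sep l x' z'"
        using sep_image[OF bij_is_inj[OF bij], of l x y x' y'] sep_image[OF bij_is_inj[OF bij], of l y z y' z']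
          sep_image[OF bij_is_inj[OF bij], of l x z x' z'] fx fy fz t by (auto simp: triple_def)
      moreover have "inside \<Gamma> l x'" "inside \<Gamma> l y'" "inside \<Gamma> l z'"
        using inside_image[OF \<Gamma> f, of l x x'] inside_image[OF \<Gamma> f, of l y y']
          inside_image[OF \<Gamma> f, of l z z'] fx fy fz t by (auto simp: triple_def)
      ultimately have t': "triple \<Gamma> l x' y' z'" using t by (auto simp: triple_def)
      have "f \<circ> tcyc x y z l = tcyc x' y' z' l \<circ> f"
        using t fx fy fz by (intro tcyc_conj bij) (auto simp: triple_def)
      from conj_eqI(1)[OF bij this] tcyc_in_cyc_group[OF t'] show ?thesis by simp
    next
      case False
      then have "\<exists>w\<in>{x, y, z}. B \<inter> {w<..<w + l} \<noteq> {}" by blast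
      then obtain w where w: "w \<in> {x, y, z}" and ne: "B \<inter> {w<..<w + l} \<noteq> {}" by blast
      from ne obtain b where b: "b \<in> B" "w < b" "b < w + l" by auto
      define a where "a = b - w"
      have "w \<in> \<Gamma>" using w t by (auto simp: triple_def inside_def)
      then have a: "a \<in> \<Gamma>" "0 < a" "a < l"
        using b B real_subgroup_diff[OF \<Gamma>, of b w] by (auto simp: a_def)
      note split = triple_split[OF \<Gamma> t a]
      have le: "N v a \<le> N v l" "N (v + a) (l - a) \<le> N v l" for v
        using a by (auto intro!: N_mono)
      have "N w a < N w l" "N (w + a) (l - a) < N w l"
        using a b by (auto intro!: N_less[of _ _ _ _ b] simp: a_def)
      then have "N x a + N y a + N z a < N x l + N y l + N z l"
        "N (x + a) (l - a) + N (y + a) (l - a) + N (z + a) (l - a) < N x l + N y l + N z l"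
        using w le[of x] le[of y] le[of z] by auto
      then have "f \<circ> tcyc x y z a \<circ> finv f \<in> cyc_group \<Gamma>"
        "f \<circ> tcyc (x + a) (y + a) (z + a) (l - a) \<circ> finv f \<in> cyc_group \<Gamma>"
        using less.hyps split(1,2) by blast+
      from perm_comp[OF cyc_group_subgroup this]
      have "(f \<circ> tcyc x y z a \<circ> finv f) \<circ> (f \<circ> tcyc (x + a) (y + a) (z + a) (l - a) \<circ> finv f) \<in> cyc_group \<Gamma>" .
      also have "(f \<circ> tcyc x y z a \<circ> finv f) \<circ> (f \<circ> tcyc (x + a) (y + a) (z + a) (l - a) \<circ> finv f) =
          f \<circ> tcyc x y z l \<circ> finv f"
        using bij unfolding split(3) by (simp add: fun_eq_iff bij_is_inj)
      finally show ?thesis .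
    qed
  qed
qed

lemma cyc_group_conj:
  assumes \<Gamma>: "subgroup \<Gamma> real_group" and f: "f \<in> iet \<Gamma>" and g: "g \<in> cyc_group \<Gamma>"
  shows "f \<circ> g \<circ> finv f \<in> cyc_group \<Gamma>"
proof -
  have bij: "bij f" using f by (auto simp: iet_def permutes_bij)
  note K = cyc_group_subgroup[of \<Gamma>]
  define M where "M = {g. bij g \<and> f \<circ> g \<circ> finv f \<in> cyc_group \<Gamma>}"
  have "perm_subgroup M"
  proof (rule perm_subgroupI)
    show "id \<in> M" using perm_id[OF K] bij by (simp add: M_def comp_inv_cancel)
  next
    fix g h assume "g \<in> M" "h \<in> M"
    then have "(f \<circ> g \<circ> finv f) \<circ> (f \<circ> h \<circ> finv f) \<in> cyc_group \<Gamma>"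
      using perm_comp[OF K] by (simp only: M_def mem_Collect_eq)
    also have "(f \<circ> g \<circ> finv f) \<circ> (f \<circ> h \<circ> finv f) = f \<circ> (g \<circ> h) \<circ> finv f"
      using bij by (simp add: fun_eq_iff bij_is_inj)
    finally show "g \<circ> h \<in> M" using \<open>g \<in> M\<close> \<open>h \<in> M\<close> by (simp only: M_def mem_Collect_eq bij_comp)
  next
    fix g assume "g \<in> M"
    then have "finv (f \<circ> g \<circ> finv f) \<in> cyc_group \<Gamma>"
      using perm_inv[OF K] by (simp only: M_def mem_Collect_eq)
    also have "finv (f \<circ> g \<circ> finv f) = f \<circ> finv g \<circ> finv f"
      using bij \<open>g \<in> M\<close> by (simp add: M_def o_inv_distrib bij_imp_bij_inv bij_comp inv_inv_eq comp_assoc)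
    finally show "finv g \<in> M" using \<open>g \<in> M\<close> by (simp only: M_def mem_Collect_eq bij_imp_bij_inv)
  qed (auto simp: M_def)
  moreover have "tcycs \<Gamma> \<subseteq> M"
    using cyc_group_conj_tcyc[OF \<Gamma> f] by (auto simp: M_def tcycs_def triple_bij)
  ultimately have "cyc_group \<Gamma> \<subseteq> M"
    unfolding cyc_group_def by (rule real_perms.generate_subgroup_incl[rotated])
  then show ?thesis using g by (auto simp: M_def)
qed

abbreviation comm :: "(real \<Rightarrow> real) \<Rightarrow> (real \<Rightarrow> real) \<Rightarrow> real \<Rightarrow> real" where
  "comm f g \<equiv> f \<circ> g \<circ> finv f \<circ> finv g"

section \<open>Commutators modulo the 3-cycles\<close>

lemma comm_inv:
  assumes "bij f" "bij g"
  shows "finv (comm f g) = comm g f"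
  using assms by (simp add: o_inv_distrib bij_imp_bij_inv bij_comp inv_inv_eq comp_assoc)

text \<open>This set is the preimage of the centralizer of \<open>g\<close> in the quotient by
  \<open>cyc_group \<Gamma>\<close>. Closure under products rests on \<open>comm (f \<circ> h) g =
  (f \<circ> comm h g \<circ> finv f) \<circ> comm f g\<close> and normality.\<close>

lemma comm_subgroup:
  assumes \<Gamma>: "subgroup \<Gamma> real_group" and g: "g \<in> iet \<Gamma>"
  shows "perm_subgroup {f \<in> iet \<Gamma>. comm f g \<in> cyc_group \<Gamma>}"
proof (rule perm_subgroupI)
  note H = iet_subgroup[OF \<Gamma>] and K = cyc_group_subgroup[of \<Gamma>]
  have bij: "bij f" if "f \<in> iet \<Gamma>" for f using that by (auto simp: iet_def permutes_bij)
  show "bij f" if "f \<in> {f \<in> iet \<Gamma>. comm f g \<in> cyc_group \<Gamma>}" for f using that bij by simp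
  show "id \<in> {f \<in> iet \<Gamma>. comm f g \<in> cyc_group \<Gamma>}"
    using perm_id[OF H] perm_id[OF K] bij[OF g] by (simp add: comp_inv_cancel)
  fix f assume "f \<in> {f \<in> iet \<Gamma>. comm f g \<in> cyc_group \<Gamma>}"
  then have f: "f \<in> iet \<Gamma>" "comm f g \<in> cyc_group \<Gamma>" by auto
  show "finv f \<in> {f \<in> iet \<Gamma>. comm f g \<in> cyc_group \<Gamma>}"
  proof -
    have "finv f \<circ> finv (comm f g) \<circ> finv (finv f) \<in> cyc_group \<Gamma>"
      by (rule cyc_group_conj[OF \<Gamma> perm_inv[OF H f(1)] perm_inv[OF K f(2)]])
    also have "finv f \<circ> finv (comm f g) \<circ> finv (finv f) = comm (finv f) g"
      unfolding comm_inv[OF bij[OF f(1)] bij[OF g]]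
      using bij[OF f(1)] bij[OF g] by (simp add: fun_eq_iff bij_is_inj inv_inv_eq)
    finally show ?thesis using perm_inv[OF H f(1)] by blast
  qed
  fix h assume "h \<in> {f \<in> iet \<Gamma>. comm f g \<in> cyc_group \<Gamma>}"
  then have h: "h \<in> iet \<Gamma>" "comm h g \<in> cyc_group \<Gamma>" by auto
  have "(f \<circ> comm h g \<circ> finv f) \<circ> comm f g \<in> cyc_group \<Gamma>"
    by (rule perm_comp[OF K cyc_group_conj[OF \<Gamma> f(1) h(2)] f(2)])
  also have "(f \<circ> comm h g \<circ> finv f) \<circ> comm f g = comm (f \<circ> h) g"
    using bij[OF f(1)] bij[OF g] bij[OF h(1)] by (simp add: fun_eq_iff bij_is_inj o_inv_distrib)
  finally show "f \<circ> h \<in> {f \<in> iet \<Gamma>. comm f g \<in> cyc_group \<Gamma>}"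
    using perm_comp[OF H f(1) h(1)] by blast
qed

text \<open>Pigeonhole: two indices near the same \<open>z\<close> have positions less than
  \<open>4 * d\<close> apart and hence coincide, so each \<open>z\<close> excludes at most one
  index. Twelve is generous; no application excludes more than six.\<close>

lemma free_index:
  fixes d :: real
  assumes "0 < d" "finite A" "finite Z" "card A + card Z < 12"
  shows "\<exists>k\<in>{1..12::nat}. k \<notin> A \<and> (\<forall>z\<in>Z. sep (2 * d) (4 * real k * d) z)"
proof (rule ccontr)
  assume n: "\<not> ?thesis"
  define near where "near z = {k\<in>{1..12::nat}. \<not> sep (2 * d) (4 * real k * d) z}" for z
  have "card (near z) \<le> 1" for z
  proof -
    have "j = k" if "j \<in> near z" "k \<in> near z" for j k
    proof -
      have "\<bar>4 * real j * d - 4 * real k * d\<bar> < 4 * d"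
        using that by (auto simp: near_def sep_def abs_if)
      also have "4 * real j * d - 4 * real k * d = 4 * d * (real j - real k)"
        by (simp add: algebra_simps)
      finally have "\<bar>real j - real k\<bar> < 1" using \<open>0 < d\<close> by (simp add: abs_mult)
      then show "j = k" by linarith
    qed
    then show ?thesis by (simp add: card_le_Suc0_iff_eq near_def)
  qed
  then have "card (\<Union>z\<in>Z. near z) \<le> (\<Sum>z\<in>Z. 1)"
    by (intro order_trans[OF card_UN_le[OF assms(3)] sum_mono])
  then have "card (A \<union> (\<Union>z\<in>Z. near z)) < 12"
    using card_Un_le[of A "\<Union>z\<in>Z. near z"] assms(4) by simp
  moreover have "card {1..12::nat} \<le> card (A \<union> (\<Union>z\<in>Z. near z))"
    using n assms(2,3) by (intro card_mono) (auto simp: near_def)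
  ultimately show False by simp
qed

section \<open>Finitely many 3-cycles suffice\<close>

lemma generate_real_sum_list:
  assumes "x \<in> generate real_group S"
  obtains ws where "set ws \<subseteq> S \<union> uminus ` S" "sum_list ws = x"
proof -
  from assms have "\<exists>ws. set ws \<subseteq> S \<union> uminus ` S \<and> sum_list ws = x"
  proof induction
    case one
    then show ?case by (auto intro: exI[of _ "[]"])
  next
    case (incl h)
    then show ?case by (auto intro: exI[of _ "[h]"])
  next
    case (inv h)
    then show ?case by (auto intro: exI[of _ "[- h]"])
  next
    case (eng h1 h2)
    then obtain ws1 ws2 where "set ws1 \<subseteq> S \<union> uminus ` S" "sum_list ws1 = h1"
      "set ws2 \<subseteq> S \<union> uminus ` S" "sum_list ws2 = h2" by blast
    then show ?case by (auto intro!: exI[of _ "ws1 @ ws2"])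
  qed
  then show ?thesis using that by blast
qed

text \<open>A sum of small steps can be reordered so that all partial sums stay in the interval.\<close>

lemma walk:
  fixes Q :: "real \<Rightarrow> bool"
  assumes S: "\<And>s. s \<in> S \<Longrightarrow> 0 \<le> s \<and> 2 * s \<le> M"
    and up: "\<And>x s. s \<in> S \<Longrightarrow> Q x \<Longrightarrow> 0 \<le> x \<Longrightarrow> x + s \<le> M \<Longrightarrow> Q (x + s)"
    and down: "\<And>x s. s \<in> S \<Longrightarrow> Q (x + s) \<Longrightarrow> 0 \<le> x \<Longrightarrow> x + s \<le> M \<Longrightarrow> Q x"
    and gen: "y - x \<in> generate real_group S"
    and "0 \<le> x" "x \<le> M" "0 \<le> y" "y \<le> M" "Q x"
  shows "Q y"
proof -
  obtain ws where "set ws \<subseteq> S \<union> uminus ` S" "sum_list ws = y - x"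
    using generate_real_sum_list[OF gen] by blast
  then show ?thesis
    using assms(5-)
  proof (induction "length ws" arbitrary: ws x)
    case 0
    then show ?case by simp
  next
    case (Suc n)
    have small: "- M \<le> 2 * w" "2 * w \<le> M" if "w \<in> set ws" for w
      using S Suc.prems(1) that by force+
    have rest: "sum_list (remove1 w ws) = y - (x + w)" if "w \<in> set ws" for w
      using Suc.prems(2) sum_list_map_remove1[OF that, of id] by simp
    have step: "Q (x + w)" if "w \<in> set ws" "0 \<le> x + w" "x + w \<le> M" for w
    proof -
      have "w \<in> S \<union> uminus ` S" using that Suc.prems(1) by blast
      then show ?thesis
      proof
        assume "w \<in> S"
        then show ?thesis using up[of w x] that Suc.prems by simp
      next
        assume "w \<in> uminus ` S"
        then have "- w \<in> S" by force
        then show ?thesis using down[of "- w" "x + w"] that Suc.prems by simp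
      qed
    qed
    have "\<exists>w\<in>set ws. 0 \<le> x + w \<and> x + w \<le> M"
    proof -
      obtain v where v: "v \<in> set ws" using Suc.hyps(2) by (cases ws) auto
      have sub: "set (remove1 w ws) \<subseteq> set ws" for w by (rule set_remove1_subset)
      \<comment> \<open>In the lower half any upward step fits, in the upper half any downward one,
        since steps are at most \<open>M / 2\<close> in size. If no such step is left, all remaining
        ones point the same way, and each keeps the position between \<open>x\<close> and the target
        \<open>y\<close>.\<close>
      consider (lo) "2 * x \<le> M" "\<exists>w\<in>set ws. 0 \<le> w" | (hi) "M < 2 * x" "\<exists>w\<in>set ws. w \<le> 0"
        | (neg) "2 * x \<le> M" "\<forall>w\<in>set ws. w \<le> 0" | (pos) "M < 2 * x" "\<forall>w\<in>set ws. 0 \<le> w"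
        by (meson linorder_not_le nle_le)
      then show ?thesis
      proof cases
        case lo
        then obtain w where "w \<in> set ws" "0 \<le> w" by blast
        with small[of w] lo Suc.prems(3) show ?thesis by (intro bexI[of _ w] conjI) (assumption | linarith)+
      next
        case hi
        then obtain w where "w \<in> set ws" "w \<le> 0" by blast
        with small[of w] hi Suc.prems(4) show ?thesis by (intro bexI[of _ w] conjI) (assumption | linarith)+
      next
        case neg
        then have "sum_list (remove1 v ws) \<le> 0" using sub by (intro sum_list_nonpos) blast
        moreover have "v \<le> 0" using v neg by blast
        ultimately show ?thesis using v neg rest[OF v] Suc.prems by (intro bexI[of _ v] conjI) (assumption | linarith)+
      next
        case pos
        then have "0 \<le> sum_list (remove1 v ws)" using sub by (intro sum_list_nonneg) blast
        moreover have "0 \<le> v" using v pos by blast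
        ultimately show ?thesis using v pos rest[OF v] Suc.prems by (intro bexI[of _ v] conjI) (assumption | linarith)+
      qed
    qed
    then obtain w where w: "w \<in> set ws" "0 \<le> x + w" "x + w \<le> M" by blast
    show ?case
    proof (rule Suc.hyps(1))
      show "n = length (remove1 w ws)" using Suc.hyps(2) w by (simp add: length_remove1)
      show "set (remove1 w ws) \<subseteq> S \<union> uminus ` S"
        using set_remove1_subset[of w ws] Suc.prems(1) by blast
      show "sum_list (remove1 w ws) = y - (x + w)" using rest[OF w(1)] .
    qed (use w step Suc.prems in auto)
  qed
qed

lemma real_subgroup_mult:
  assumes \<Gamma>: "subgroup \<Gamma> real_group" and "x \<in> \<Gamma>"
  shows "of_int k * x \<in> \<Gamma>" "of_nat n * x \<in> \<Gamma>"
proof -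
  show nat: "of_nat n * x \<in> \<Gamma>" for n
    using assms real_subgroup_add[OF \<Gamma>] real_subgroup_zero[OF \<Gamma>]
    by (induction n) (auto simp: algebra_simps)
  show "of_int k * x \<in> \<Gamma>"
    using nat real_subgroup_minus[OF \<Gamma>] by (cases k rule: int_cases2) fastforce+
qed

lemma dense_obtain:
  fixes \<Gamma> :: "real set"
  assumes "closure \<Gamma> = UNIV" "a < b"
  obtains x where "x \<in> \<Gamma>" "a < x" "x < b"
proof -
  have "(a + b) / 2 \<in> closure \<Gamma>" using assms by simp
  then obtain x where "x \<in> \<Gamma>" "dist x ((a + b) / 2) < (b - a) / 2"
    using assms(2) by (metis closure_approachable diff_gt_0_iff_gt half_gt_zero)
  then show ?thesis using that by (auto simp: dist_real_def abs_if field_simps split: if_splits)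
qed

lemma floor_remainder:
  fixes t v :: real
  assumes "0 < v"
  shows "0 \<le> t - of_int \<lfloor>t / v\<rfloor> * v" "t - of_int \<lfloor>t / v\<rfloor> * v < v"
proof -
  have "of_int \<lfloor>t / v\<rfloor> * v \<le> t / v * v" "t / v * v < (of_int \<lfloor>t / v\<rfloor> + 1) * v"
    using assms by (intro mult_right_mono mult_strict_right_mono; linarith)+
  then show "0 \<le> t - of_int \<lfloor>t / v\<rfloor> * v" "t - of_int \<lfloor>t / v\<rfloor> * v < v"
    using assms by (auto simp: algebra_simps)
qed

text \<open>Each generator is reduced modulo a small \<open>v\<close> and then translated by
  \<open>u\<close> into the interval; \<open>u\<close> and \<open>u + v\<close> are added so that
  \<open>u\<close>, \<open>v\<close> and the old generators can be recovered. Taking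
  \<open>u\<close> in the lower half and \<open>v\<close> below half the length keeps everything
  under \<beta>.\<close>

lemma generators_in_interval:
  assumes \<Gamma>: "subgroup \<Gamma> real_group" and dense: "closure \<Gamma> = UNIV"
    and T: "finite T" "generate real_group T = \<Gamma>" and ab: "0 \<le> \<alpha>" "\<alpha> < \<beta>"
  obtains S where "finite S" "S \<subseteq> \<Gamma>" "S \<subseteq> {\<alpha><..<\<beta>}" "generate real_group S = \<Gamma>"
proof -
  obtain u where u: "u \<in> \<Gamma>" "\<alpha> < u" "u < (\<alpha> + \<beta>) / 2"
    using dense_obtain[OF dense, of \<alpha> "(\<alpha> + \<beta>) / 2"] ab by auto
  obtain v where v: "v \<in> \<Gamma>" "0 < v" "v < (\<beta> - \<alpha>) / 2"
    using dense_obtain[OF dense, of 0 "(\<beta> - \<alpha>) / 2"] ab by auto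
  define w where "w t = t - of_int \<lfloor>t / v\<rfloor> * v" for t
  have w: "0 \<le> w t" "w t < v" for t
    using floor_remainder[OF v(2)] by (simp_all add: w_def)
  define S where "S = insert u (insert (u + v) ((\<lambda>t. u + w t) ` T))"
  have T\<Gamma>: "T \<subseteq> \<Gamma>" using T(2) generate.incl[of _ T real_group] by blast
  have w\<Gamma>: "w t \<in> \<Gamma>" if "t \<in> T" for t
    unfolding w_def using that T\<Gamma> v real_subgroup_mult[OF \<Gamma>] by (intro real_subgroup_diff[OF \<Gamma>]) auto
  have S: "S \<subseteq> \<Gamma>" using u v w\<Gamma> by (auto simp: S_def intro!: real_subgroup_add[OF \<Gamma>])
  have G: "subgroup (generate real_group S) real_group"
    by (rule real_group.generate_is_subgroup) auto
  have "u \<in> generate real_group S" "u + v \<in> generate real_group S"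
    by (auto simp: S_def intro: generate.incl)
  from this(1) real_subgroup_diff[OF G this(2,1)]
  have uv: "u \<in> generate real_group S" "v \<in> generate real_group S" by simp_all
  have "t \<in> generate real_group S" if "t \<in> T" for t
  proof -
    have "u + w t \<in> generate real_group S" using that by (auto simp: S_def intro: generate.incl)
    from real_subgroup_add[OF G real_subgroup_diff[OF G this uv(1)] real_subgroup_mult(1)[OF G uv(2), of "\<lfloor>t / v\<rfloor>"]]
    show ?thesis by (simp add: w_def)
  qed
  then have "generate real_group T \<subseteq> generate real_group S"
    by (intro real_group.generate_subgroup_incl[OF _ G]) blast
  moreover have "generate real_group S \<subseteq> \<Gamma>" by (rule real_group.generate_subgroup_incl[OF S \<Gamma>])
  ultimately have "generate real_group S = \<Gamma>" using T by blast
  moreover have "u + w t < \<beta>" "\<alpha> < u + w t" for t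
    using w[of t] u v ab by (auto simp: field_simps)
  then have "S \<subseteq> {\<alpha><..<\<beta>}" using u v ab by (auto simp: S_def field_simps)
  ultimately show ?thesis using that[of S] S T by (simp add: S_def)
qed

section \<open>Transport of 3-cycles by conjugation within a subgroup\<close>

definition moves :: "(real \<Rightarrow> real) \<Rightarrow> real \<Rightarrow> real \<Rightarrow> real \<Rightarrow> bool" where
  "moves g l x x' \<longleftrightarrow> (\<forall>t. x < t \<longrightarrow> t \<le> x + l \<longrightarrow> g t = t - x + x')"

lemma moves_tcyc: "x \<le> u \<Longrightarrow> u + k \<le> x + l \<Longrightarrow> u' = u - x + y \<Longrightarrow> moves (tcyc x y z l) k u u'"
  by (auto simp: moves_def tcyc_def)

lemma fixes_tcyc:
  assumes "u + k \<le> x \<or> x + l \<le> u" "u + k \<le> y \<or> y + l \<le> u" "u + k \<le> z \<or> z + l \<le> u"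
  shows "moves (tcyc x y z l) k u u"
  using assms by (auto simp: moves_def tcyc_def)

text \<open>An equivalence, since \<open>K\<close> also contains the inverse of \<open>g\<close>.
  Below, membership of 3-cycles in \<open>K\<close> is transported from place to place by this
  rule.\<close>

lemma tcyc_move_iff:
  assumes K: "perm_subgroup K" and "g \<in> K" and sep: "sep l x y" "sep l y z" "sep l x z"
    and "moves g l x x'" "moves g l y y'" "moves g l z z'"
  shows "tcyc x' y' z' l \<in> K \<longleftrightarrow> tcyc x y z l \<in> K"
proof -
  have bij: "bij g" using perm_bij[OF K \<open>g \<in> K\<close>] .
  have "g \<circ> tcyc x y z l = tcyc x' y' z' l \<circ> g"
    using assms by (intro tcyc_conj bij) (auto simp: moves_def)
  note * = conj_eqI[OF bij this]
  show ?thesis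
    using perm_conj[OF K \<open>g \<in> K\<close>, of "tcyc x y z l"]
      perm_comp[OF K perm_comp[OF K perm_inv[OF K \<open>g \<in> K\<close>], of "tcyc x' y' z' l"] \<open>g \<in> K\<close>]
    unfolding * by blast
qed

text \<open>The reference positions go up to \<open>48 * d\<close> and carry intervals of length up
  to \<open>2 * d\<close>, so \<open>100 * d \<le> 1\<close> leaves ample room.\<close>

locale small_element =
  fixes \<Gamma> :: "real set" and d :: real
  assumes \<Gamma>: "subgroup \<Gamma> real_group" and d\<Gamma>: "d \<in> \<Gamma>" and one\<Gamma>: "1 \<in> \<Gamma>"
    and d_pos: "0 < d" and d_small: "100 * d \<le> 1"
begin

text \<open>Twelve reference positions: since they are \<open>4 * d\<close> apart, each interval of length at most \<open>2 * d\<close>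
  gets close to at most one of them, so there is always one away from all intervals in play.\<close>

definition p :: "nat \<Rightarrow> real" where
  "p k = 4 * real k * d"

text \<open>The displacement \<open>c\<close> to the left serves cycles that overlap a reference
  interval only partly. Numbering from 1 puts the lowest position at \<open>4 * d\<close>, which
  leaves room for it.\<close>

lemma p_inside:
  assumes "k \<in> {1..12}" "l \<le> 2 * d" "0 \<le> c" "c \<le> d" "c \<in> \<Gamma>"
  shows "inside \<Gamma> l (p k - c)"
proof -
  have "p k \<in> \<Gamma>" using real_subgroup_mult(2)[OF \<Gamma> d\<Gamma>, of "4 * k"] by (simp add: p_def)
  then have "p k - c \<in> \<Gamma>" using real_subgroup_diff[OF \<Gamma>] assms by blast
  moreover have "1 * d \<le> real k * d" "real k * d \<le> 12 * d"
    using assms(1) d_pos by (intro mult_right_mono; simp)+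
  ultimately show ?thesis using assms d_small by (simp add: inside_def p_def)
qed

lemma p_inside': "k \<in> {1..12} \<Longrightarrow> l \<le> 2 * d \<Longrightarrow> inside \<Gamma> l (p k)"
  using p_inside[of k l 0] real_subgroup_zero[OF \<Gamma>] d_pos by simp

lemma p_sep: "j \<noteq> k \<Longrightarrow> sep (4 * d) (p j) (p k)"
proof (induction j k rule: linorder_wlog)
  case (le j k)
  then have "real j + 1 \<le> real k" by linarith
  from mult_right_mono[OF this, of "4 * d"] d_pos show ?case
    by (simp add: sep_def p_def algebra_simps)
next
  case (sym j k)
  then show ?case by (simp add: sep_sym)
qed

lemma free_p:
  assumes "length as + length zs < 12"
  obtains k where "k \<in> {1..12}" "k \<notin> set as" "list_all (sep (2 * d) (p k)) zs"
proof -
  have "card (set as) + card (set zs) < 12"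
    using assms card_length[of as] card_length[of zs] by linarith
  then show ?thesis
    using free_index[OF d_pos, of "set as" "set zs"] that unfolding p_def list_all_iff by blast
qed

text \<open>Demanding all admissible pairs of reference positions, not just one pair, allows several
  points to be compared through a common pair that is far from all of them.\<close>

definition linked :: "(real \<Rightarrow> real) set \<Rightarrow> real \<Rightarrow> real \<Rightarrow> bool" where
  "linked K l x \<longleftrightarrow> (\<forall>i\<in>{1..12}. \<forall>j\<in>{1..12}. i \<noteq> j \<longrightarrow> sep (2 * d) (p i) x \<longrightarrow> sep (2 * d) (p j) x \<longrightarrow>
     tcyc x (p i) (p j) l \<in> K)"

lemma p_sep_le: "j \<noteq> k \<Longrightarrow> l \<le> 4 * d \<Longrightarrow> sep l (p j) (p k)"
  using p_sep sep_mono by blast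

text \<open>One pair is enough: conjugation by a 3-cycle of reference positions that avoids
  \<open>x\<close> and one member of the pair replaces the other member, and inversion exchanges the
  two.\<close>

lemma linkedI:
  assumes K: "perm_subgroup K" and l: "0 < l" "l \<le> d"
    and base: "\<And>a b c. a \<in> {1..12} \<Longrightarrow> b \<in> {1..12} \<Longrightarrow> c \<in> {1..12} \<Longrightarrow> a \<noteq> b \<Longrightarrow> b \<noteq> c \<Longrightarrow> a \<noteq> c \<Longrightarrow>
      tcyc (p a) (p b) (p c) l \<in> K"
    and ij: "i \<in> {1..12}" "j \<in> {1..12}" "i \<noteq> j" "sep (2 * d) (p i) x" "sep (2 * d) (p j) x"
      "tcyc x (p i) (p j) l \<in> K"
  shows "linked K l x"
proof -
  define F where "F = {k \<in> {1..12}. sep (2 * d) (p k) x}"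
  define R where "R i j \<longleftrightarrow> tcyc x (p i) (p j) l \<in> K" for i j
  have sepx: "sep l (p k) x" "sep l x (p k)" if "k \<in> F" for k
    using that l d_pos sep_mono[of "2 * d" "p k" x l] by (auto simp: F_def sep_sym)
  have sepp: "sep l (p j) (p k)" if "j \<noteq> k" for j k
    using p_sep_le[OF that] l d_pos by simp
  have sym: "R j i" if "R i j" "i \<in> F" "j \<in> F" "i \<noteq> j" for i j
    using perm_inv[OF K, of "tcyc x (p i) (p j) l"] inv_tcyc[of l x "p i" "p j"] that sepx sepp
    by (simp add: R_def)
  have replace: "R i k" if "R i j" "i \<in> F" "j \<in> F" "k \<in> F" "i \<noteq> j" "i \<noteq> k" for i j k
  proof (cases "j = k")
    case False
    obtain m where m: "m \<in> {1..12}" "m \<notin> {i, j, k}" "sep (2 * d) (p m) x"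
      using free_p[of "[i, j, k]" "[x]"] by auto
    then have mF: "m \<in> F" by (simp add: F_def)
    have "tcyc (p j) (p k) (p m) l \<in> K" using that m False by (intro base) (auto simp: F_def)
    moreover have "moves (tcyc (p j) (p k) (p m) l) l x x"
      using sepx[OF \<open>j \<in> F\<close>] sepx[OF \<open>k \<in> F\<close>] sepx[OF mF] by (intro fixes_tcyc) (simp_all only: sep_def)
    moreover have "moves (tcyc (p j) (p k) (p m) l) l (p i) (p i)"
      using sepp[OF \<open>i \<noteq> j\<close>] sepp[OF \<open>i \<noteq> k\<close>] sepp[of i m] m by (intro fixes_tcyc) (simp_all add: sep_def)
    moreover have "moves (tcyc (p j) (p k) (p m) l) l (p j) (p k)"
      by (intro moves_tcyc) auto
    ultimately show ?thesis
      using tcyc_move_iff[OF K, of "tcyc (p j) (p k) (p m) l" l x "p i" "p j" x "p i" "p k"] that sepx sepp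
      by (simp add: R_def)
  qed (use that in simp)
  have R: "R i j" "i \<in> F" "j \<in> F" using ij by (auto simp: R_def F_def)
  have "R k n" if "k \<in> F" "n \<in> F" "k \<noteq> n" for k n
  proof -
    \<comment> \<open>The detour through a fresh index keeps the two members of each intermediate
      pair distinct, even when the old and the new pair overlap.\<close>
    obtain m where m: "m \<in> {1..12}" "m \<notin> {i, j, k, n}" "sep (2 * d) (p m) x"
      using free_p[of "[i, j, k, n]" "[x]"] by auto
    then have mF: "m \<in> F" by (simp add: F_def)
    have "R m i" using replace[OF R mF] sym[of i m] R m ij mF by auto
    then have "R m n" using replace[of m i n] R m that mF by auto
    then have "R n k" using sym[of m n] replace[of n m k] m that mF by auto
    then show ?thesis using sym that by auto
  qed
  then show ?thesis by (auto simp: linked_def F_def R_def)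
qed

text \<open>Starting from the cycle of \<open>x\<close>, \<open>p i\<close>, \<open>p j\<close>,
  conjugation by the cycle of \<open>p i\<close>, \<open>y\<close>, \<open>p j\<close> yields that
  of \<open>x\<close>, \<open>y\<close>, \<open>p i\<close>; conjugation by the cycle of
  \<open>p i\<close>, \<open>z\<close>, \<open>p j\<close> then replaces \<open>p i\<close> by
  \<open>z\<close>.\<close>

lemma linked_combine:
  assumes K: "perm_subgroup K" and "l \<le> d" and t: "triple \<Gamma> l x y z"
    and "linked K l x" "linked K l y" "linked K l z"
  shows "tcyc x y z l \<in> K"
proof -
  obtain i where i: "i \<in> {1..12}" "\<And>w. w \<in> {x, y, z} \<Longrightarrow> sep (2 * d) (p i) w"
    using free_p[of "[]" "[x, y, z]"] by auto
  obtain j where j: "j \<in> {1..12}" "j \<noteq> i" "\<And>w. w \<in> {x, y, z} \<Longrightarrow> sep (2 * d) (p j) w"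
    using free_p[of "[i]" "[x, y, z]"] by auto
  have cyc: "tcyc w (p i) (p j) l \<in> K" "tcyc w (p j) (p i) l \<in> K" if "w \<in> {x, y, z}" for w
    using assms(4-6) i j that by (auto simp: linked_def)
  have sepp: "sep l (p i) (p j)" "sep l (p j) (p i)"
    using p_sep_le[of i j l] j \<open>l \<le> d\<close> d_pos by (auto simp: sep_sym)
  have sepw: "sep l w (p i)" "sep l w (p j)" "sep l (p i) w" "sep l (p j) w" if "w \<in> {x, y, z}" for w
    using sep_mono[OF i(2)[OF that]] sep_mono[OF j(3)[OF that]] \<open>l \<le> d\<close> d_pos by (auto simp: sep_sym)
  have sep: "sep l x y" "sep l y z" "sep l x z" "sep l y x" "sep l z y" "sep l z x"
    using t by (auto simp: triple_def sep_sym)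
  have "tcyc (p i) y (p j) l \<in> K"
    using cyc(2)[of y] tcyc_rotate[of l "p i" y "p j"] sepw[of y] sepp by simp
  moreover have "moves (tcyc (p i) y (p j) l) l x x"
    using sepw[of x] sep by (intro fixes_tcyc) (simp_all add: sep_def)
  moreover have "moves (tcyc (p i) y (p j) l) l (p i) y"
    by (intro moves_tcyc) auto
  moreover have "moves (tcyc (p i) y (p j) l) l (p j) (p i)"
  proof -
    have "tcyc (p i) y (p j) l = tcyc (p j) (p i) y l"
      using tcyc_rotate[of l "p j" "p i" y] sepw[of y] sepp by simp
    then show ?thesis by (simp add: moves_tcyc)
  qed
  ultimately have 1: "tcyc x y (p i) l \<in> K"
    using tcyc_move_iff[OF K, of "tcyc (p i) y (p j) l" l x "p i" "p j" x y "p i"]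
      cyc(1)[of x] sepw[of x] sepp by simp
  have "tcyc (p i) z (p j) l \<in> K"
    using cyc(2)[of z] tcyc_rotate[of l "p i" z "p j"] sepw[of z] sepp by simp
  moreover have "moves (tcyc (p i) z (p j) l) l x x"
    using sepw[of x] sep by (intro fixes_tcyc) (simp_all add: sep_def)
  moreover have "moves (tcyc (p i) z (p j) l) l y y"
    using sepw[of y] sep by (intro fixes_tcyc) (simp_all add: sep_def)
  moreover have "moves (tcyc (p i) z (p j) l) l (p i) z"
    by (intro moves_tcyc) auto
  ultimately show ?thesis
    using tcyc_move_iff[OF K, of "tcyc (p i) z (p j) l" l x y "p i" x y z] 1 sepw[of x] sepw[of y] sep by simp
qed

section \<open>A finite set of 3-cycles that links all positions\<close>

definition base_cycles :: "(real \<Rightarrow> real) set" where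
  "base_cycles = {tcyc (p a) (p b) (p c) d | a b c.
     a \<in> {1..12} \<and> b \<in> {1..12} \<and> c \<in> {1..12} \<and> a \<noteq> b \<and> b \<noteq> c \<and> a \<noteq> c}"

text \<open>Windows of length \<open>2 * d\<close> such that every interval of length \<open>d\<close> that can be shifted by \<open>s\<close>
  lies in one of them.\<close>

definition windows :: "real \<Rightarrow> real set" where
  "windows s = {X. inside \<Gamma> (2 * d + s) X \<and> (X = 1 - s - 2 * d \<or> (\<exists>n. X = real n * d))}"

definition window_cycles :: "real set \<Rightarrow> (real \<Rightarrow> real) set" where
  "window_cycles S = {tcyc X (X + s) (p k) (2 * d) | X s k.
     s \<in> S \<and> X \<in> windows s \<and> k \<in> {1..12} \<and> triple \<Gamma> (2 * d) X (X + s) (p k)}"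

lemma finite_windows: 
  assumes "0 \<le> s"
  shows "finite (windows s)"
proof -
  have "X \<in> insert (1 - s - 2 * d) ((\<lambda>n. real n * d) ` {..nat \<lceil>1 / d\<rceil>})" if "X \<in> windows s" for X
  proof -
    have "n \<le> nat \<lceil>1 / d\<rceil>" if "real n * d \<le> 1" for n
    proof -
      have "real n \<le> 1 / d" using that d_pos by (simp add: field_simps)
      then show ?thesis by linarith
    qed
    then show ?thesis
      using that assms d_pos by (auto simp: windows_def inside_def)
  qed
  then show ?thesis by (meson finite.insertI finite_atMost finite_imageI finite_subset subsetI)
qed

lemma finite_base_cycles: "finite base_cycles"
proof -
  have "base_cycles \<subseteq> (\<lambda>(a, b, c). tcyc (p a) (p b) (p c) d) ` ({1..12} \<times> {1..12} \<times> {1..12})"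
    by (force simp: base_cycles_def)
  then show ?thesis by (rule finite_subset) auto
qed

lemma finite_window_cycles:
  assumes "finite S" "\<And>s. s \<in> S \<Longrightarrow> 0 \<le> s"
  shows "finite (window_cycles S)"
proof -
  have "window_cycles S \<subseteq> (\<lambda>(s, X, k). tcyc X (X + s) (p k) (2 * d)) ` (SIGMA s:S. windows s \<times> {1..12})"
    by (force simp: window_cycles_def)
  then show ?thesis
    using assms finite_windows by (elim finite_subset) (intro finite_imageI finite_SigmaI finite_cartesian_product; simp)
qed

lemma triple_p:
  assumes "a \<in> {1..12}" "b \<in> {1..12}" "c \<in> {1..12}" "a \<noteq> b" "b \<noteq> c" "a \<noteq> c" "l \<in> \<Gamma>" "0 < l" "l \<le> 2 * d"
  shows "triple \<Gamma> l (p a) (p b) (p c)"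
  using assms p_inside' p_sep_le[of _ _ l] d_pos by (auto simp: triple_def)

lemma base_cycles_subset: "base_cycles \<subseteq> cyc_group \<Gamma>"
  using d_pos d\<Gamma> by (auto simp: base_cycles_def intro!: tcyc_in_cyc_group triple_p)

lemma window_cycles_subset: "window_cycles S \<subseteq> cyc_group \<Gamma>"
  by (auto simp: window_cycles_def intro!: tcyc_in_cyc_group)

lemma window_obtain:
  assumes "x \<in> \<Gamma>" "s \<in> \<Gamma>" "0 \<le> x" "0 \<le> s" "x + s + d \<le> 1" "s + 2 * d \<le> 1"
  obtains X where "X \<in> windows s" "X \<le> x" "x + d \<le> X + 2 * d"
proof -
  define n where "n = nat \<lfloor>x / d\<rfloor>"
  have "real n \<le> x / d" "x / d < real n + 1" using assms d_pos by (simp_all add: n_def)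
  then have n: "real n * d \<le> x" "x < real n * d + d" using d_pos by (simp_all add: field_simps)
  show ?thesis
  proof (cases "real n * d + (2 * d + s) \<le> 1")
    case True
    then have "real n * d \<in> windows s"
      using d_pos real_subgroup_mult(2)[OF \<Gamma> d\<Gamma>, of n] by (auto simp: windows_def inside_def)
    then show ?thesis using that[of "real n * d"] n by simp
  next
    \<comment> \<open>The window at \<open>n * d\<close> would overrun 1 after the shift. The last
      admissible window starts still further left and ends at \<open>1 - s\<close>, so it contains
      the interval.\<close>
    case False
    have "1 - s - (d + d) \<in> \<Gamma>"
      by (intro real_subgroup_diff[OF \<Gamma>] real_subgroup_add[OF \<Gamma>] one\<Gamma> d\<Gamma> assms)
    then have "1 - s - 2 * d \<in> windows s" using assms by (simp add: windows_def inside_def)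
    then show ?thesis using that[of "1 - s - 2 * d"] n False assms by simp
  qed
qed

text \<open>A window around (x, x + d] is carried to its translate by a 3-cycle in \<open>K\<close>,
  disjointness of the two being the reason for \<open>2 * d \<le> s\<close>. The pair
  \<open>p i\<close>, \<open>p j\<close> is chosen away from the support of this cycle and from
  \<open>x\<close> and \<open>x + s\<close>, so conjugation changes only the first interval.\<close>

lemma linked_step:
  assumes K: "perm_subgroup K" "base_cycles \<subseteq> K" "window_cycles S \<subseteq> K"
    and s: "s \<in> S" "s \<in> \<Gamma>" "2 * d \<le> s" "4 * s \<le> 1"
    and x: "x \<in> \<Gamma>" "0 \<le> x" "x + s \<le> 1 - d"
  shows "linked K d x \<longleftrightarrow> linked K d (x + s)"
proof -
  obtain X where X: "X \<in> windows s" "X \<le> x" "x + d \<le> X + 2 * d"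
    using window_obtain[of x s] x s d_pos d_small by (auto simp: algebra_simps)
  then have inX: "inside \<Gamma> (2 * d) X" "inside \<Gamma> (2 * d) (X + s)"
    using s d_pos real_subgroup_add[OF \<Gamma>] by (auto simp: windows_def inside_def)
  obtain k where k: "k \<in> {1..12}" "sep (2 * d) (p k) X" "sep (2 * d) (p k) (X + s)"
    using free_p[of "[]" "[X, X + s]"] by auto
  obtain i where i: "i \<in> {1..12}" "i \<noteq> k"
    "list_all (sep (2 * d) (p i)) [X, X + s, x, x + s]"
    using free_p[of "[k]" "[X, X + s, x, x + s]"] by auto
  obtain j where j: "j \<in> {1..12}" "j \<noteq> i" "j \<noteq> k"
    "list_all (sep (2 * d) (p j)) [X, X + s, x, x + s]"
    using free_p[of "[k, i]" "[X, X + s, x, x + s]"] by auto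
  have "d + d \<in> \<Gamma>" using real_subgroup_add[OF \<Gamma> d\<Gamma> d\<Gamma>] .
  moreover have "sep (2 * d) X (X + s)" using s by (simp add: sep_def)
  ultimately have "triple \<Gamma> (2 * d) X (X + s) (p k)"
    using k inX p_inside' d_pos by (auto simp: triple_def sep_sym)
  then have g: "tcyc X (X + s) (p k) (2 * d) \<in> K" (is "?g \<in> K")
    using K(3) s X k by (auto simp: window_cycles_def)
  have fixes_p: "moves ?g d (p m) (p m)" if "m \<noteq> k" "sep (2 * d) (p m) X" "sep (2 * d) (p m) (X + s)" for m
    using that p_sep[of m k] d_pos by (intro fixes_tcyc) (auto simp: sep_def)
  have seps: "sep d x (p m)" "sep d (x + s) (p m)"
    if "sep (2 * d) (p m) x" "sep (2 * d) (p m) (x + s)" for m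
    using that d_pos by (auto simp: sep_sym intro: sep_mono)
  have iff: "tcyc (x + s) (p i) (p j) d \<in> K \<longleftrightarrow> tcyc x (p i) (p j) d \<in> K"
  proof (rule tcyc_move_iff[OF K(1) g])
    show "moves ?g d x (x + s)" using X by (intro moves_tcyc) auto
    show "moves ?g d (p i) (p i)" "moves ?g d (p j) (p j)"
      using i j by (auto intro!: fixes_p)
    show "sep d (p i) (p j)" using p_sep_le[of i j d] j d_pos by simp
    show "sep d x (p i)" "sep d x (p j)" using seps[of i] seps[of j] i j by auto
  qed
  have base: "tcyc (p a) (p b) (p c) d \<in> K"
    if "a \<in> {1..12}" "b \<in> {1..12}" "c \<in> {1..12}" "a \<noteq> b" "b \<noteq> c" "a \<noteq> c" for a b c
    using that K(2) by (auto simp: base_cycles_def)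
  have intro: "linked K d w" if "tcyc w (p i) (p j) d \<in> K" "w \<in> {x, x + s}" for w
    using linkedI[OF K(1) d_pos order_refl base, of i j w] i j that by auto
  have "tcyc w (p i) (p j) d \<in> K" if "linked K d w" "w \<in> {x, x + s}" for w
    using that i j by (auto simp: linked_def)
  then show ?thesis using iff intro by blast
qed

text \<open>The base cycles link \<open>p 1\<close>; every other position is reached from it by a
  walk in [0, 1 - d] with steps from \<open>S\<close>, for which \<open>4 * s \<le> 1\<close> is
  small enough.\<close>

lemma linked_all:
  assumes K: "perm_subgroup K" "base_cycles \<subseteq> K" "window_cycles S \<subseteq> K"
    and S: "generate real_group S = \<Gamma>" "\<And>s. s \<in> S \<Longrightarrow> 2 * d \<le> s \<and> 4 * s \<le> 1"
    and x: "inside \<Gamma> d x"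
  shows "linked K d x"
proof -
  have S\<Gamma>: "S \<subseteq> \<Gamma>" using S(1) generate.incl[of _ S real_group] by blast
  have "linked K d (p 1)"
    using K(2) d_pos unfolding linked_def base_cycles_def by (fastforce simp: sep_def)
  have p1: "inside \<Gamma> d (p 1)" using p_inside'[of 1 d] d_pos by simp
  have "p 1 \<in> \<Gamma>" "0 \<le> p 1" "p 1 \<le> 1 - d" and x': "x \<in> \<Gamma>" "0 \<le> x" "x \<le> 1 - d"
    using p1 x by (auto simp: inside_def)
  have step: "linked K d y \<longleftrightarrow> linked K d (y + s)"
    if "s \<in> S" "y \<in> \<Gamma>" "0 \<le> y" "y + s \<le> 1 - d" for y s
    using linked_step[OF K that(1) _ _ _ that(2-)] S(2) S\<Gamma> that(1) by blast
  have "x \<in> \<Gamma> \<and> linked K d x"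
  proof (rule walk[of S "1 - d" "\<lambda>x. x \<in> \<Gamma> \<and> linked K d x" x "p 1"])
    show "0 \<le> s \<and> 2 * s \<le> 1 - d" if "s \<in> S" for s
      using S(2)[OF that] d_pos d_small by linarith
    show "y + s \<in> \<Gamma> \<and> linked K d (y + s)"
      if "s \<in> S" "y \<in> \<Gamma> \<and> linked K d y" "0 \<le> y" "y + s \<le> 1 - d" for y s
      using that step[of s y] S\<Gamma> real_subgroup_add[OF \<Gamma>, of y s] by blast
    show "y \<in> \<Gamma> \<and> linked K d y"
      if *: "s \<in> S" "y + s \<in> \<Gamma> \<and> linked K d (y + s)" "0 \<le> y" "y + s \<le> 1 - d" for y s
    proof -
      have "y + s - s \<in> \<Gamma>" using * S\<Gamma> by (intro real_subgroup_diff[OF \<Gamma>]) auto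
      then show ?thesis using * step[of s y] by simp
    qed
    show "x - p 1 \<in> generate real_group S"
      using real_subgroup_diff[OF \<Gamma> x'(1) \<open>p 1 \<in> \<Gamma>\<close>] S(1) by simp
  qed (fact | use \<open>linked K d (p 1)\<close> \<open>p 1 \<in> \<Gamma>\<close> in blast)+
  then show ?thesis ..
qed

text \<open>The second cycle starts \<open>\<delta> = d - l\<close> to the left of
  \<open>p a\<close>, so it meets the first exactly in (p a, p a + l]. Displacing \<open>p c\<close>
  by the same \<delta> makes the short interval in the commutator start at \<open>p c\<close>; the
  auxiliary positions \<open>e\<close> and \<open>f\<close> drop out.\<close>

lemma base_short:
  assumes K: "perm_subgroup K" and all: "\<And>x y z. triple \<Gamma> d x y z \<Longrightarrow> tcyc x y z d \<in> K"
    and l: "l \<in> \<Gamma>" "0 < l" "l \<le> d"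
    and abc: "a \<in> {1..12}" "b \<in> {1..12}" "c \<in> {1..12}" "a \<noteq> b" "b \<noteq> c" "a \<noteq> c"
  shows "tcyc (p a) (p b) (p c) l \<in> K"
proof -
  obtain e where e: "e \<in> {1..12}" "e \<notin> {a, b, c}"
    using free_p[of "[a, b, c]" "[]"] by auto
  obtain f where f: "f \<in> {1..12}" "f \<notin> {a, b, c, e}"
    using free_p[of "[a, b, c, e]" "[]"] by auto
  define \<delta> where "\<delta> = d - l"
  have \<delta>: "\<delta> \<in> \<Gamma>" "0 \<le> \<delta>" "\<delta> \<le> d" using l d\<Gamma> real_subgroup_diff[OF \<Gamma>] by (auto simp: \<delta>_def)
  have sep: "sep d (p j - u) (p k - v)" if "j \<noteq> k" "u \<in> {0, \<delta>}" "v \<in> {0, \<delta>}" for j k u v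
    using p_sep[OF that(1)] that(2,3) \<delta> d_pos by (auto simp: sep_def)
  have sep0: "sep d (p j - \<delta>) (p k)" "sep d (p j) (p k - \<delta>)" "sep d (p j - \<delta>) (p k - \<delta>)" "sep d (p j) (p k)"
    if "j \<noteq> k" for j k
    using sep[OF that, of \<delta> 0] sep[OF that, of 0 \<delta>] sep[OF that, of \<delta> \<delta>] sep[OF that, of 0 0] by simp_all
  have "triple \<Gamma> d (p a) (p b) (p e)"
    using abc e d_pos d\<Gamma> by (intro triple_p) auto
  moreover have "triple \<Gamma> d (p a - \<delta>) (p c - \<delta>) (p f)"
    unfolding triple_def using abc e f \<delta> d_pos d\<Gamma> by (auto intro!: p_inside p_inside' sep0)
  ultimately have in_K: "tcyc (p a) (p b) (p e) d \<in> K" "tcyc (p a - \<delta>) (p c - \<delta>) (p f) d \<in> K"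
    using all by blast+
  have "tcyc (p a) (p b) (p e) d \<circ> tcyc (p a - \<delta>) (p c - \<delta>) (p f) d =
    tcyc (p a) (p b) (p c) l \<circ> (tcyc (p a - \<delta>) (p c - \<delta>) (p f) d \<circ> tcyc (p a) (p b) (p e) d)"
    (is "?c1 \<circ> ?c2 = ?c \<circ> (?c2 \<circ> ?c1)")
    using abc e f l by (intro tcyc_intersect sep0) (auto simp: \<delta>_def)
  moreover have "bij (?c2 \<circ> ?c1)" using perm_bij[OF K] in_K by (simp add: bij_comp)
  ultimately have "?c = (?c1 \<circ> ?c2) \<circ> finv (?c2 \<circ> ?c1)"
    using comp_finv_eqI by metis
  also have "\<dots> \<in> K" by (intro perm_comp[OF K] perm_inv[OF K] in_K)
  finally show ?thesis .
qed

text \<open>The interval (w, w + l] sits at offset \<delta> in an interval of length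
  \<open>d\<close>. A 3-cycle of length \<open>d\<close> starting \<delta> before \<open>p m\<close>
  therefore carries (p m, p m + l] to it while fixing \<open>p i\<close> and \<open>p j\<close>,
  which transports the short cycles of reference positions.\<close>

lemma short_cycles:
  assumes K: "perm_subgroup K" and all: "\<And>x y z. triple \<Gamma> d x y z \<Longrightarrow> tcyc x y z d \<in> K"
    and t: "triple \<Gamma> l x y z" and "l \<le> d"
  shows "tcyc x y z l \<in> K"
proof -
  have l: "l \<in> \<Gamma>" "0 < l" "l \<le> d" using t \<open>l \<le> d\<close> by (auto simp: triple_def)
  note base = base_short[OF K all l]
  have "linked K l w" if w: "inside \<Gamma> l w" for w
  proof -
    \<comment> \<open>Close to 1 the surrounding interval of length \<open>d\<close> has to end at
      \<open>w + l\<close> instead of starting at \<open>w\<close>.\<close>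
    define w' where "w' = (if w + d \<le> 1 then w else w + l - d)"
    define \<delta> where "\<delta> = w - w'"
    have \<delta>: "\<delta> \<in> \<Gamma>" "0 \<le> \<delta>" "\<delta> + l \<le> d"
    proof -
      have "\<delta> = 0 \<or> \<delta> = d - l" by (auto simp: \<delta>_def w'_def)
      then show "\<delta> \<in> \<Gamma>" "0 \<le> \<delta>" "\<delta> + l \<le> d"
        using l d\<Gamma> real_subgroup_diff[OF \<Gamma>] real_subgroup_zero[OF \<Gamma>] by auto
    qed
    have w': "inside \<Gamma> d w'"
      using w l d\<Gamma> d_small real_subgroup_diff[OF \<Gamma>] real_subgroup_add[OF \<Gamma>] by (auto simp: w'_def inside_def)
    obtain i where i: "i \<in> {1..12}" "sep (2 * d) (p i) w"
      using free_p[of "[]" "[w]"] by auto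
    obtain j where j: "j \<in> {1..12}" "j \<notin> {i}" "sep (2 * d) (p j) w"
      using free_p[of "[i]" "[w]"] by auto
    obtain m where m: "m \<in> {1..12}" "m \<notin> {i, j}" "sep (2 * d) (p m) w" "sep (2 * d) (p m) w'"
      using free_p[of "[i, j]" "[w, w']"] by auto
    obtain n where n: "n \<in> {1..12}" "n \<notin> {i, j, m}" "sep (2 * d) (p n) w" "sep (2 * d) (p n) w'"
      using free_p[of "[i, j, m]" "[w, w']"] by auto
    have \<delta>d: "\<delta> \<le> d" using \<delta> l by simp
    have seps: "sep d (p m - \<delta>) w'" "sep d w' (p n - \<delta>)" "sep d (p m - \<delta>) (p n - \<delta>)"
      using m(4) n(2,4) \<delta>(2) \<delta>d l p_sep[of m n] by (simp_all add: sep_def) linarith+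
    then have "triple \<Gamma> d (p m - \<delta>) w' (p n - \<delta>)"
      using m n \<delta> \<delta>d w' d_pos d\<Gamma> by (auto simp: triple_def intro!: p_inside)
    then have h: "tcyc (p m - \<delta>) w' (p n - \<delta>) d \<in> K" (is "?h \<in> K") by (rule all)
    have fixes_p: "moves ?h l (p q) (p q)" if "q \<noteq> m" "q \<noteq> n" "sep (2 * d) (p q) w" for q
      using that(3) p_sep[OF that(1)] p_sep[OF that(2)] \<delta> l unfolding sep_def
      by (intro fixes_tcyc) (auto simp: \<delta>_def)
    have "tcyc w (p i) (p j) l \<in> K \<longleftrightarrow> tcyc (p m) (p i) (p j) l \<in> K"
    proof (rule tcyc_move_iff[OF K h])
      show "moves ?h l (p m) w" using \<delta> l by (intro moves_tcyc) (auto simp: \<delta>_def)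
      show "moves ?h l (p i) (p i)" "moves ?h l (p j) (p j)" using i j m n by (auto intro!: fixes_p)
      show "sep l (p m) (p i)" "sep l (p i) (p j)" "sep l (p m) (p j)"
        using i j m l d_pos by (auto intro!: p_sep_le)
    qed
    moreover have "tcyc (p m) (p i) (p j) l \<in> K" using i j m by (intro base) auto
    ultimately show ?thesis
      using linkedI[OF K l(2,3) base, of i j w] i j by auto
  qed
  then show ?thesis
    using linked_combine[OF K \<open>l \<le> d\<close> t] t by (auto simp: triple_def)
qed

lemma cyc_group_subset_if_short:
  assumes K: "perm_subgroup K" and all: "\<And>x y z. triple \<Gamma> d x y z \<Longrightarrow> tcyc x y z d \<in> K"
  shows "cyc_group \<Gamma> \<subseteq> K"
proof -
  have "tcyc x y z l \<in> K" if "l \<le> real n * d" "triple \<Gamma> l x y z" for n x y z l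
    using that
  proof (induction n arbitrary: x y z l)
    case 0
    then show ?case by (simp add: triple_def)
  next
    case (Suc n)
    show ?case
    proof (cases "l \<le> d")
      case True
      then show ?thesis using short_cycles[OF K all Suc.prems(2)] by blast
    next
      case False
      then have "d < l" by simp
      note split = triple_split[OF \<Gamma> Suc.prems(2) d\<Gamma> d_pos this]
      have "l - d \<le> real n * d" using Suc.prems(1) by (simp add: algebra_simps)
      from perm_comp[OF K all[OF split(1)] Suc.IH[OF this split(2)]]
      show ?thesis by (simp only: split(3))
    qed
  qed
  moreover have "\<exists>n. l \<le> real n * d" for l
    using d_pos real_arch_simple[of "l / d"] by (auto simp: field_simps)
  ultimately have "tcycs \<Gamma> \<subseteq> K" by (force simp: tcycs_def)
  then show ?thesis
    unfolding cyc_group_def by (rule real_perms.generate_subgroup_incl[OF _ K])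
qed

lemma cyc_group_eq_generate:
  assumes S: "generate real_group S = \<Gamma>" "\<And>s. s \<in> S \<Longrightarrow> 2 * d \<le> s \<and> 4 * s \<le> 1"
  shows "generate real_perms (base_cycles \<union> window_cycles S) = cyc_group \<Gamma>" (is "?K = _")
proof
  have sub: "base_cycles \<union> window_cycles S \<subseteq> cyc_group \<Gamma>"
    using base_cycles_subset window_cycles_subset by blast
  then show "?K \<subseteq> cyc_group \<Gamma>"
    by (rule real_perms.generate_subgroup_incl[OF _ cyc_group_subgroup])
  have K: "perm_subgroup ?K"
    using sub subgroup.subset[OF cyc_group_subgroup[of \<Gamma>]] by (intro real_perms.generate_is_subgroup) blast
  have "base_cycles \<subseteq> ?K" "window_cycles S \<subseteq> ?K" by (auto intro: generate.incl)
  note linked = linked_all[OF K this S]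
  show "cyc_group \<Gamma> \<subseteq> ?K"
    by (rule cyc_group_subset_if_short[OF K])
       (rule linked_combine[OF K order_refl], auto simp: triple_def intro!: linked)
qed

section \<open>The derived subgroup and generators of the whole group\<close>

text \<open>The 3-cycle \<open>h\<close> conjugates \<open>rot x a b\<close> to a rotation whose
  support is disjoint from that of \<open>g\<close>. Both that rotation and \<open>h\<close>
  centralize \<open>g\<close> modulo the 3-cycles, hence so does \<open>rot x a b\<close>.\<close>

lemma small_rots_comm:
  assumes a: "a \<in> \<Gamma>" "0 \<le> a" "a \<le> d" and b: "b \<in> \<Gamma>" "0 \<le> b" "b \<le> d" and x: "inside \<Gamma> (a + b) x"
    and a': "a' \<in> \<Gamma>" "0 \<le> a'" "a' \<le> d" and b': "b' \<in> \<Gamma>" "0 \<le> b'" "b' \<le> d"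
    and x': "inside \<Gamma> (a' + b') x'"
  shows "comm (rot x a b) (rot x' a' b') \<in> cyc_group \<Gamma>"
proof (cases "a + b = 0")
  case True
  then have "a = 0" using a b by linarith
  then have "rot x a b = id" by simp
  moreover have "bij (rot x' a' b')" using a' b' by (simp add: bij_rot)
  ultimately have "comm (rot x a b) (rot x' a' b') = id"
    by (simp add: comp_inv_cancel)
  then show ?thesis using perm_id[OF cyc_group_subgroup] by (simp only:)
next
  case False
  define g where "g = rot x' a' b'"
  have g: "g \<in> iet \<Gamma>" unfolding g_def using a' b' x' by (intro rot_in_iet[OF \<Gamma>])
  have bijg: "bij g" using a' b' by (simp add: g_def bij_rot)
  note M = comm_subgroup[OF \<Gamma> g]
  let ?M = "{f \<in> iet \<Gamma>. comm f g \<in> cyc_group \<Gamma>}"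
  obtain k where k: "k \<in> {1..12}" "sep (2 * d) (p k) x" "sep (2 * d) (p k) x'"
    using free_p[of "[]" "[x, x']"] by auto
  obtain m where m: "m \<in> {1..12}" "m \<notin> {k}" "sep (2 * d) (p m) x" "sep (2 * d) (p m) x'"
    using free_p[of "[k]" "[x, x']"] by auto
  have ab: "a + b \<in> \<Gamma>" "0 < a + b" "a + b \<le> 2 * d"
    using a b False real_subgroup_add[OF \<Gamma>] by auto
  have t: "triple \<Gamma> (a + b) x (p k) (p m)"
    using k m ab x p_inside' p_sep_le[of k m "a + b"] d_pos sep_mono[OF _ ab(3)]
    by (auto simp: triple_def sep_sym)
  define h where "h = tcyc x (p k) (p m) (a + b)"
  have h: "h \<in> cyc_group \<Gamma>" "bij h" using tcyc_in_cyc_group[OF t] triple_bij[OF t] by (simp_all add: h_def)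
  have "h \<in> ?M"
  proof -
    \<comment> \<open>Bracketed this way, the commutator is \<open>h\<close> times a conjugate of
      its inverse, and both factors lie in the normal subgroup.\<close>
    have "h \<circ> (g \<circ> finv h \<circ> finv g) \<in> cyc_group \<Gamma>"
      by (intro perm_comp[OF cyc_group_subgroup] cyc_group_conj[OF \<Gamma> g] perm_inv[OF cyc_group_subgroup] h)
    then have "comm h g \<in> cyc_group \<Gamma>" by (simp only: comp_assoc)
    moreover have "h \<in> iet \<Gamma>" using cyc_group_subset_iet[OF \<Gamma>] h by blast
    ultimately show ?thesis by blast
  qed
  moreover have "rot (p k) a b \<in> ?M"
  proof -
    have "rot (p k) a b \<circ> g = g \<circ> rot (p k) a b"
      unfolding g_def using k a b a' b' by (intro rot_commute) (auto simp: sep_def)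
    moreover have "bij (rot (p k) a b)" using a b by (simp add: bij_rot)
    ultimately have "comm (rot (p k) a b) g = id"
      using bijg by (metis comp_finv_eqI comp_inv_cancel(2))
    moreover have "rot (p k) a b \<in> iet \<Gamma>"
      using a b k ab by (intro rot_in_iet[OF \<Gamma>] p_inside') auto
    ultimately show ?thesis using perm_id[OF cyc_group_subgroup[of \<Gamma>]] by (simp only: mem_Collect_eq)
  qed
  ultimately have "finv h \<circ> rot (p k) a b \<circ> h \<in> ?M"
    by (intro perm_comp[OF M] perm_inv[OF M])
  moreover have "h \<circ> rot x a b = rot (p k) a b \<circ> h"
    using a b h(2) by (intro rot_conj) (auto simp: h_def tcyc_def)
  note conj_eqI(2)[OF h(2) this]
  ultimately have "rot x a b \<in> ?M" by (simp only:)
  then show ?thesis by (simp add: g_def)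
qed

text \<open>The centralizer argument is used once per argument: against a fixed small rotation it
  passes from small rotations to all \<open>f\<close>, and then, with \<open>f\<close> fixed, to all
  elements in the other place.\<close>

lemma iet_comm:
  assumes "f \<in> iet \<Gamma>" "g \<in> iet \<Gamma>"
  shows "comm f g \<in> cyc_group \<Gamma>"
proof -
  define small where "small r \<longleftrightarrow> (\<exists>x a b. r = rot x a b \<and> a \<in> \<Gamma> \<and> 0 \<le> a \<and> a \<le> d \<and> b \<in> \<Gamma> \<and> 0 \<le> b \<and> b \<le> d \<and>
    inside \<Gamma> (a + b) x)" for r
  have gen: "iet \<Gamma> \<subseteq> K" if "perm_subgroup K" "\<And>r. small r \<Longrightarrow> r \<in> K" for K
    using that(2) unfolding small_def by (intro iet_subset_if_small_rots[OF \<Gamma> one\<Gamma> that(1) d\<Gamma> d_pos]) blast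
  have small_iet: "r \<in> iet \<Gamma>" if "small r" for r
    using that by (auto simp: small_def intro!: rot_in_iet[OF \<Gamma>])
  have 1: "comm f r \<in> cyc_group \<Gamma>" if "f \<in> iet \<Gamma>" "small r" for f r
  proof -
    have "iet \<Gamma> \<subseteq> {f \<in> iet \<Gamma>. comm f r \<in> cyc_group \<Gamma>}"
    proof (rule gen[OF comm_subgroup[OF \<Gamma> small_iet[OF that(2)]]])
      fix q assume q: "small q"
      then have "comm q r \<in> cyc_group \<Gamma>"
        using that(2) small_rots_comm unfolding small_def by blast
      then show "q \<in> {f \<in> iet \<Gamma>. comm f r \<in> cyc_group \<Gamma>}" using small_iet[OF q] by blast
    qed
    then show ?thesis using that(1) by blast
  qed
  have bij: "bij f" if "f \<in> iet \<Gamma>" for f using perm_bij[OF iet_subgroup[OF \<Gamma>] that] .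
  have "iet \<Gamma> \<subseteq> {h \<in> iet \<Gamma>. comm h f \<in> cyc_group \<Gamma>}"
  proof (rule gen[OF comm_subgroup[OF \<Gamma> assms(1)]])
    fix r assume r: "small r"
    have "finv (comm f r) \<in> cyc_group \<Gamma>"
      by (rule perm_inv[OF cyc_group_subgroup 1[OF assms(1) r]])
    then show "r \<in> {h \<in> iet \<Gamma>. comm h f \<in> cyc_group \<Gamma>}"
      using small_iet[OF r] unfolding comm_inv[OF bij[OF assms(1)] bij[OF small_iet[OF r]]] by blast
  qed
  then have "comm g f \<in> cyc_group \<Gamma>" using assms(2) by blast
  from perm_inv[OF cyc_group_subgroup this] show ?thesis
    unfolding comm_inv[OF bij[OF assms(2)] bij[OF assms(1)]] .
qed

lemma derived_iet: "derived real_perms (iet \<Gamma>) = cyc_group \<Gamma>"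
proof
  have bij: "bij f" if "f \<in> iet \<Gamma>" for f using perm_bij[OF iet_subgroup[OF \<Gamma>] that] .
  have "derived_set real_perms (iet \<Gamma>) \<subseteq> cyc_group \<Gamma>"
    using iet_comm bij by (auto simp del: o_apply)
  then show "derived real_perms (iet \<Gamma>) \<subseteq> cyc_group \<Gamma>"
    unfolding derived_def by (rule real_perms.generate_subgroup_incl[OF _ cyc_group_subgroup])
  have "iet \<Gamma> \<subseteq> carrier real_perms" using subgroup.subset[OF iet_subgroup[OF \<Gamma>]] .
  note D = real_perms.derived_is_subgroup[OF this]
  have "tcyc x y z l \<in> derived real_perms (iet \<Gamma>)" if t: "triple \<Gamma> l x y z" for x y z l
  proof -
    have s: "swp x y l \<in> iet \<Gamma>" "swp x z l \<in> iet \<Gamma>"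
      using t by (auto simp: triple_def intro!: swp_in_iet[OF \<Gamma>])
    have "tcyc x y z l = comm (swp x y l) (swp x z l)"
      using t by (simp add: triple_def tcyc_eq_commutator inv_swp)
    then have "tcyc x y z l = swp x y l \<otimes>\<^bsub>real_perms\<^esub> swp x z l \<otimes>\<^bsub>real_perms\<^esub> inv\<^bsub>real_perms\<^esub> (swp x y l)
      \<otimes>\<^bsub>real_perms\<^esub> inv\<^bsub>real_perms\<^esub> (swp x z l)"
      using s[THEN bij] by simp
    then show ?thesis unfolding derived_def using s by (intro generate.incl) blast
  qed
  then show "cyc_group \<Gamma> \<subseteq> derived real_perms (iet \<Gamma>)"
    unfolding cyc_group_def by (intro real_perms.generate_subgroup_incl[OF _ D]) (auto simp: tcycs_def)
qed

text \<open>All positions at once, because a subgroup containing the 3-cycles cannot tell positions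
  of a short rotation apart; only the lengths matter.\<close>

definition has_rots :: "(real \<Rightarrow> real) set \<Rightarrow> real \<Rightarrow> real \<Rightarrow> bool" where
  "has_rots K a b \<longleftrightarrow> (\<forall>x. inside \<Gamma> (a + b) x \<longrightarrow> rot x a b \<in> K)"

text \<open>A 3-cycle of length \<open>a + b\<close> carries the support of the rotation to a
  reference position, so the twelve rotations there determine all the others.\<close>

lemma has_rotsI:
  assumes K: "perm_subgroup K" "cyc_group \<Gamma> \<subseteq> K"
    and a: "a \<in> \<Gamma>" "0 \<le> a" "a \<le> d" and b: "b \<in> \<Gamma>" "0 \<le> b" "b \<le> d"
    and p: "\<And>k. k \<in> {1..12} \<Longrightarrow> rot (p k) a b \<in> K"
  shows "has_rots K a b"
  unfolding has_rots_def
proof (intro allI impI)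
  fix x assume x: "inside \<Gamma> (a + b) x"
  show "rot x a b \<in> K"
  proof (cases "a + b = 0")
    case True
    then have "a = 0" using a b by linarith
    then have "rot x a b = id" by simp
    then show ?thesis using perm_id[OF K(1)] by (simp only:)
  next
    case False
    obtain k where k: "k \<in> {1..12}" "sep (2 * d) (p k) x"
      using free_p[of "[]" "[x]"] by auto
    obtain m where m: "m \<in> {1..12}" "m \<notin> {k}" "sep (2 * d) (p m) x"
      using free_p[of "[k]" "[x]"] by auto
    have ab: "a + b \<in> \<Gamma>" "0 < a + b" "a + b \<le> 2 * d"
      using a b False real_subgroup_add[OF \<Gamma>] by auto
    have t: "triple \<Gamma> (a + b) x (p k) (p m)"
      using k m ab x p_inside' p_sep_le[of k m "a + b"] d_pos sep_mono[OF _ ab(3)]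
      by (auto simp: triple_def sep_sym)
    define h where "h = tcyc x (p k) (p m) (a + b)"
    have h: "h \<in> K" "bij h" using tcyc_in_cyc_group[OF t] K triple_bij[OF t] by (auto simp: h_def)
    have "h \<circ> rot x a b = rot (p k) a b \<circ> h"
      using a b h(2) by (intro rot_conj) (auto simp: h_def tcyc_def)
    moreover have "finv h \<circ> rot (p k) a b \<circ> h \<in> K"
      by (intro perm_comp[OF K(1)] perm_inv[OF K(1)] h p k)
    ultimately show ?thesis using conj_eqI(2)[OF h(2)] by metis
  qed
qed

lemma has_rots_sym:
  assumes K: "perm_subgroup K" and "0 \<le> a" "0 \<le> b" "has_rots K a b"
  shows "has_rots K b a"
  unfolding has_rots_def
proof (intro allI impI)
  fix x assume "inside \<Gamma> (b + a) x"
  then have "finv (rot x a b) \<in> K"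
    using assms perm_inv[OF K] by (simp add: has_rots_def add.commute)
  then show "rot x b a \<in> K" using assms by (simp add: inv_rot)
qed

lemma has_rots_add:
  assumes K: "perm_subgroup K" and "0 \<le> a" "0 \<le> a'" "0 \<le> b" "a \<in> \<Gamma>" "has_rots K a b" "has_rots K a' b"
  shows "has_rots K (a + a') b"
  unfolding has_rots_def
proof (intro allI impI)
  fix x assume "inside \<Gamma> (a + a' + b) x"
  then have "rot x a b \<in> K" "rot (x + a) a' b \<in> K"
    using assms real_subgroup_add[OF \<Gamma>, of x a] by (auto simp: has_rots_def inside_def)
  from perm_comp[OF K this] show "rot x (a + a') b \<in> K"
    using assms by (simp only: rot_split_left)
qed

text \<open>The longer rotation has to fit into the unit interval: the extra block \<open>a'\<close>
  is put to the right of \<open>a\<close> if there is room, and to the left of it otherwise. The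
  bound on \<open>a + 2 * a' + b\<close> guarantees one of the two.\<close>

lemma has_rots_cancel:
  assumes K: "perm_subgroup K" and "0 \<le> a" "0 \<le> a'" "0 \<le> b" "a \<in> \<Gamma>" "a' \<in> \<Gamma>" "a + 2 * a' + b \<le> 1"
    and R: "has_rots K (a + a') b" "has_rots K a' b"
  shows "has_rots K a b"
  unfolding has_rots_def
proof (intro allI impI)
  fix x assume x: "inside \<Gamma> (a + b) x"
  show "rot x a b \<in> K"
  proof (cases "x + (a + a' + b) \<le> 1")
    case True
    then have in_K: "rot x (a + a') b \<in> K" "rot (x + a) a' b \<in> K"
      using R x assms real_subgroup_add[OF \<Gamma>, of x a] by (auto simp: has_rots_def inside_def)
    have "rot x (a + a') b \<circ> finv (rot (x + a) a' b) = rot x a b"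
      using assms by (intro comp_finv_eqI rot_split_left bij_rot)
    then show ?thesis using perm_comp[OF K in_K(1) perm_inv[OF K in_K(2)]] by (simp only:)
  next
    case False
    then have in_K: "rot (x - a') (a' + a) b \<in> K" "rot (x - a') a' b \<in> K"
      using R x assms real_subgroup_diff[OF \<Gamma>, of x a'] by (auto simp: has_rots_def inside_def add.commute)
    have "rot (x - a') (a' + a) b = rot (x - a') a' b \<circ> rot x a b"
      using rot_split_left[of a' a b "x - a'"] assms by simp
    then have "rot x a b = finv (rot (x - a') a' b) \<circ> rot (x - a') (a' + a) b"
      using assms by (simp only: comp_inv_cancel(3)[OF bij_rot])
    then show ?thesis using perm_comp[OF K perm_inv[OF K in_K(2)] in_K(1)] by (simp only:)
  qed
qed

text \<open>Here \<open>walk\<close> runs through lengths in [0, d] instead of positions, starting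
  at the trivial rotation; upward steps use additivity, downward steps cancellation.\<close>

lemma has_rots_walk:
  assumes K: "perm_subgroup K"
    and S: "generate real_group S = \<Gamma>" "\<And>s. s \<in> S \<Longrightarrow> 0 \<le> s \<and> 2 * s \<le> d"
    and R: "\<And>s. s \<in> S \<Longrightarrow> has_rots K s b"
    and a: "a \<in> \<Gamma>" "0 \<le> a" "a \<le> d" and b: "0 \<le> b" "b \<le> d"
  shows "has_rots K a b"
proof -
  have S\<Gamma>: "S \<subseteq> \<Gamma>" using S(1) generate.incl[of _ S real_group] by blast
  have "a \<in> \<Gamma> \<and> has_rots K a b"
  proof (rule walk[of S d "\<lambda>a. a \<in> \<Gamma> \<and> has_rots K a b" a 0])
    fix x s assume *: "s \<in> S" "x \<in> \<Gamma> \<and> has_rots K x b" "0 \<le> x" "x + s \<le> d"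
    then show "x + s \<in> \<Gamma> \<and> has_rots K (x + s) b"
      using has_rots_add[OF K, of x s b] R[of s] S(2)[of s] S\<Gamma> real_subgroup_add[OF \<Gamma>, of x s] b by blast
  next
    fix x s assume *: "s \<in> S" "x + s \<in> \<Gamma> \<and> has_rots K (x + s) b" "0 \<le> x" "x + s \<le> d"
    then have "x + s - s \<in> \<Gamma>" using S\<Gamma> by (intro real_subgroup_diff[OF \<Gamma>]) auto
    moreover have "x + 2 * s + b \<le> 1" using * S(2)[of s] b d_small by simp
    ultimately show "x \<in> \<Gamma> \<and> has_rots K x b"
      using has_rots_cancel[OF K, of x s b] * R[of s] S(2)[of s] S\<Gamma> b by auto
  next
    show "0 \<in> \<Gamma> \<and> has_rots K 0 b"
      using real_subgroup_zero[OF \<Gamma>] perm_id[OF K] by (simp only: has_rots_def rot_0 simp_thms)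
  qed (use S a d_pos in auto)
  then show ?thesis ..
qed

definition rot_gens :: "real set \<Rightarrow> (real \<Rightarrow> real) set" where
  "rot_gens S = {rot (p k) s s' | k s s'. k \<in> {1..12} \<and> s \<in> S \<and> s' \<in> S}"

lemma finite_rot_gens: "finite S \<Longrightarrow> finite (rot_gens S)"
  by (rule finite_subset[of _ "(\<lambda>(k, s, s'). rot (p k) s s') ` ({1..12} \<times> S \<times> S)"])
     (force simp: rot_gens_def)+

lemma iet_eq_generate:
  assumes W: "generate real_perms W = cyc_group \<Gamma>"
    and S: "generate real_group S = \<Gamma>" "\<And>s. s \<in> S \<Longrightarrow> 0 \<le> s \<and> 2 * s \<le> d"
  shows "generate real_perms (W \<union> rot_gens S) = iet \<Gamma>" (is "?K = _")
proof
  have S\<Gamma>: "S \<subseteq> \<Gamma>" using S(1) generate.incl[of _ S real_group] by blast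
  have "W \<subseteq> iet \<Gamma>"
    using W generate.incl[of _ W real_perms] cyc_group_subset_iet[OF \<Gamma>] by blast
  moreover have "rot_gens S \<subseteq> iet \<Gamma>"
  proof
    fix r assume "r \<in> rot_gens S"
    then obtain k s s' where r: "r = rot (p k) s s'" and k: "k \<in> {1..12}" and s: "s \<in> S" "s' \<in> S"
      by (auto simp: rot_gens_def)
    have "inside \<Gamma> (s + s') (p k)" using S(2)[OF s(1)] S(2)[OF s(2)] k by (intro p_inside') auto
    then show "r \<in> iet \<Gamma>"
      unfolding r using s S(2) S\<Gamma> by (intro rot_in_iet[OF \<Gamma>]) auto
  qed
  ultimately have sub: "W \<union> rot_gens S \<subseteq> iet \<Gamma>" by blast
  then show "?K \<subseteq> iet \<Gamma>"
    by (rule real_perms.generate_subgroup_incl[OF _ iet_subgroup[OF \<Gamma>]])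
  have K: "perm_subgroup ?K"
    using sub subgroup.subset[OF iet_subgroup[OF \<Gamma>]] by (intro real_perms.generate_is_subgroup) blast
  have cyc: "cyc_group \<Gamma> \<subseteq> ?K" using real_perms.mono_generate[of W] W by blast
  have base: "has_rots ?K s s'" if "s \<in> S" "s' \<in> S" for s s'
  proof (rule has_rotsI[OF K cyc])
    show "rot (p k) s s' \<in> ?K" if "k \<in> {1..12}" for k
      using that \<open>s \<in> S\<close> \<open>s' \<in> S\<close> by (intro generate.incl UnI2) (auto simp: rot_gens_def)
  qed (use that S(2)[of s] S(2)[of s'] S\<Gamma> in \<open>simp_all add: subset_iff\<close>)
  \<comment> \<open>The lengths are freed one at a time: a walk in the first argument, an exchange
    of the arguments by inversion, and below a second walk.\<close>
  have one: "has_rots ?K s a" if "s \<in> S" "a \<in> \<Gamma>" "0 \<le> a" "a \<le> d" for s a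
  proof -
    have "0 \<le> s" "s \<le> d" using S(2)[OF that(1)] by auto
    from has_rots_walk[OF K S base[OF _ that(1)] that(2-) this]
    show ?thesis by (rule has_rots_sym[OF K \<open>0 \<le> a\<close> \<open>0 \<le> s\<close>])
  qed
  have "has_rots ?K a b" if "a \<in> \<Gamma>" "0 \<le> a" "a \<le> d" "b \<in> \<Gamma>" "0 \<le> b" "b \<le> d" for a b
    by (rule has_rots_walk[OF K S one[OF _ that(4-6)] that(1-3) that(5,6)])
  then show "iet \<Gamma> \<subseteq> ?K"
    by (intro iet_subset_if_small_rots[OF \<Gamma> one\<Gamma> K d\<Gamma> d_pos]) (auto simp: has_rots_def)
qed

end

section \<open>Generators of the group of shifts, and the transfer to \<open>IE\<close>\<close>

text \<open>The shift at \<open>t\<close> depends only on the set of breakpoints below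
  \<open>t\<close>, and \<open>B\<close> has finitely many subsets.\<close>

lemma finite_shifts:
  assumes "finite B" "piecewise_translation B f"
  shows "finite (range (\<lambda>t. f t - t))"
proof -
  define below where "below t = {b \<in> B. b < t}" for t
  define rep where "rep C = inv_into UNIV below C" for C
  have "f t - t = f (rep (below t)) - rep (below t)" for t
  proof -
    have "below (rep (below t)) = below t" unfolding rep_def by (rule f_inv_into_f) simp
    then have "same_cell B t (rep (below t))" by (auto simp: same_cell_def below_def)
    then show ?thesis using assms(2) by (simp only: piecewise_translation_def)
  qed
  then have "range (\<lambda>t. f t - t) \<subseteq> (\<lambda>C. f (rep C) - rep C) ` Pow B"
    by (force simp: below_def)
  then show ?thesis using assms(1) finite_subset by blast
qed

text \<open>Shifts of composites are sums of shifts, so all shifts of elements generated by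
  \<open>W\<close> lie in the group generated by those of \<open>W\<close>. Containing the 3-cycles
  is all that is asked of \<open>W\<close>, which covers the derived subgroup and the whole group
  alike.\<close>

lemma finitely_many_shifts_generate:
  assumes \<Gamma>: "subgroup \<Gamma> real_group" and dense: "closure \<Gamma> = UNIV"
    and W: "finite W" "W \<subseteq> iet \<Gamma>" "cyc_group \<Gamma> \<subseteq> generate real_perms W"
  shows "\<exists>T. finite T \<and> generate real_group T = \<Gamma>"
proof -
  define T where "T = (\<Union>f\<in>W. range (\<lambda>t. f t - t))"
  let ?G = "generate real_group T"
  have "finite (range (\<lambda>t. f t - t))" if "f \<in> W" for f
    using that W(2) finite_shifts[of _ f] by (auto simp: iet_def)
  then have fin: "finite T" using W(1) by (simp add: T_def)
  have "T \<subseteq> \<Gamma>" using W(2) by (auto simp: T_def iet_def)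
  then have sub: "?G \<subseteq> \<Gamma>" by (rule real_group.generate_subgroup_incl[OF _ \<Gamma>])
  have G: "subgroup ?G real_group" by (rule real_group.generate_is_subgroup) simp
  define M where "M = {f. bij f \<and> (\<forall>t. f t - t \<in> ?G)}"
  have "perm_subgroup M"
  proof (rule perm_subgroupI)
    show "id \<in> M" using real_subgroup_zero[OF G] by (simp add: M_def)
  next
    fix f g assume "f \<in> M" "g \<in> M"
    then have "(f (g t) - g t) + (g t - t) \<in> ?G" for t
      by (intro real_subgroup_add[OF G]) (auto simp: M_def)
    then show "f \<circ> g \<in> M" using \<open>f \<in> M\<close> \<open>g \<in> M\<close> by (simp add: M_def bij_comp)
  next
    fix f assume f: "f \<in> M"
    have "finv f t - t \<in> ?G" for t
    proof -
      have "f (finv f t) - finv f t \<in> ?G" using f by (simp add: M_def)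
      from real_subgroup_minus[OF G this] show ?thesis
        using f by (simp add: M_def bij_is_surj surj_f_inv_f)
    qed
    then show "finv f \<in> M" using f by (simp add: M_def bij_imp_bij_inv)
  qed (simp add: M_def)
  moreover have "W \<subseteq> M"
    using W(2) by (auto simp: M_def T_def iet_def permutes_bij intro!: generate.incl)
  ultimately have M: "cyc_group \<Gamma> \<subseteq> M"
    using W(3) real_perms.generate_subgroup_incl[of W M] by blast
  have small: "\<gamma> \<in> ?G" if \<gamma>: "\<gamma> \<in> \<Gamma>" "0 < \<gamma>" "\<gamma> < 1 / 4" for \<gamma>
  proof -
    obtain l where l: "l \<in> \<Gamma>" "0 < l" "l < \<gamma>" using dense_obtain[OF dense \<gamma>(2)] .
    obtain z where z: "z \<in> \<Gamma>" "1 / 2 < z" "z < 3 / 4"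
      using dense_obtain[OF dense, of "1 / 2" "3 / 4"] by auto
    \<comment> \<open>The cycle realizes \<gamma> as the shift of (0, l]. Since
      \<open>l < \<gamma> < 1 / 4\<close>, the second interval ends before 1/2, and \<open>z\<close>
      is placed beyond that.\<close>
    have "triple \<Gamma> l 0 \<gamma> z"
      using l z \<gamma> real_subgroup_zero[OF \<Gamma>] by (simp add: triple_def inside_def sep_def)
    from tcyc_in_cyc_group[OF this] have "tcyc 0 \<gamma> z l l - l \<in> ?G" using M by (auto simp: M_def)
    then show ?thesis using l by (simp add: tcyc_def)
  qed
  obtain v where v: "v \<in> \<Gamma>" "0 < v" "v < 1 / 4"
    using dense_obtain[OF dense, of 0 "1 / 4"] by auto
  have "\<gamma> \<in> ?G" if \<gamma>: "\<gamma> \<in> \<Gamma>" for \<gamma>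
  proof -
    define k w where "k = \<lfloor>\<gamma> / v\<rfloor>" and "w = \<gamma> - of_int k * v"
    have kw: "\<gamma> = of_int k * v + w" "0 \<le> w" "w < v"
      using floor_remainder[OF v(2), of \<gamma>] by (simp_all add: k_def w_def)
    have "w \<in> \<Gamma>"
      using real_subgroup_diff[OF \<Gamma> \<gamma> real_subgroup_mult(1)[OF \<Gamma> v(1), of k]] kw by simp
    then have "w \<in> ?G" using small[of w] kw v real_subgroup_zero[OF G] by (cases "w = 0") auto
    from real_subgroup_add[OF G real_subgroup_mult(1)[OF G small[OF v], of k] this]
    show ?thesis using kw by simp
  qed
  then show ?thesis using fin sub by blast
qed

section \<open>Restriction to the unit interval as an isomorphism onto \<open>IE\<close>\<close>

definition unit_restrict :: "(real \<Rightarrow> real) \<Rightarrow> real \<Rightarrow> real" where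
  "unit_restrict f = restrict f {0..1}"

lemma iet_unit:
  assumes "f \<in> iet \<Gamma>"
  shows "bij_betw f {0..1} {0..1}" "f 0 = 0"
proof -
  have f: "f permutes {0<..1}" using assms by (simp add: iet_def)
  then have "f permutes {0..1}" by (rule permutes_subset) auto
  then show "bij_betw f {0..1} {0..1}" by (rule permutes_imp_bij)
  show "f 0 = 0" using permutes_not_in[OF f, of 0] by simp
qed

lemma unit_restrict_Bij: "f \<in> iet \<Gamma> \<Longrightarrow> unit_restrict f \<in> Bij {0..1}"
  using iet_unit(1)[of f \<Gamma>] by (simp add: Bij_def unit_restrict_def)

lemma inj_on_unit_restrict: "inj_on unit_restrict (iet \<Gamma>)"
proof (rule inj_onI, rule ext)
  fix f g t assume *: "f \<in> iet \<Gamma>" "g \<in> iet \<Gamma>" "unit_restrict f = unit_restrict g"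
  show "f t = g t"
  proof (cases "t \<in> {0..1}")
    case True
    then show ?thesis using fun_cong[OF *(3), of t] by (simp add: unit_restrict_def)
  next
    case False
    then have t: "t \<notin> {0<..1}" by auto
    have "f permutes {0<..1}" "g permutes {0<..1}" using * by (auto simp: iet_def)
    then show ?thesis using t permutes_not_in by metis
  qed
qed

lemma unit_restrict_in_IE:
  assumes \<Gamma>: "subgroup \<Gamma> real_group" and "1 \<in> \<Gamma>" and f: "f \<in> iet \<Gamma>"
  shows "unit_restrict f \<in> IE_set \<Gamma>"
proof -
  from f obtain B where B: "finite B" "B \<subseteq> \<Gamma>" "piecewise_translation B f" by (auto simp: iet_def)
  define xs where "xs = sorted_list_of_set (insert 0 (insert 1 (B \<inter> {0..1})))"
  have set: "set xs = insert 0 (insert 1 (B \<inter> {0..1}))" 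
    unfolding xs_def by (rule set_sorted_list_of_set) (use B in simp)
  have sorted: "xs ! i < xs ! j" if "i < j" "j < length xs" for i j
    using that strict_sorted_list_of_set[of "insert 0 (insert 1 (B \<inter> {0..1}))"]
    by (simp add: xs_def sorted_wrt_nth_less)
  have unit: "0 \<le> xs ! i" "xs ! i \<le> 1" "xs ! i \<in> \<Gamma>" if "i < length xs" for i
  proof -
    have "xs ! i \<in> insert 0 (insert 1 (B \<inter> {0..1}))" using nth_mem[OF that] unfolding set .
    then show "0 \<le> xs ! i" "xs ! i \<le> 1" "xs ! i \<in> \<Gamma>"
      using B \<open>1 \<in> \<Gamma>\<close> real_subgroup_zero[OF \<Gamma>] by auto
  qed
  obtain i0 where i0: "i0 < length xs" "xs ! i0 = 0" using set by (metis in_set_conv_nth insertI1)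
  obtain i1 where i1: "i1 < length xs" "xs ! i1 = 1" using set by (metis in_set_conv_nth insertI1 insertI2)
  have "i0 = 0" using sorted[of 0 i0] unit[of 0] i0 by force
  have "\<not> i1 < length xs - 1"
    using sorted[of i1 "length xs - 1"] unit[of "length xs - 1"] i1 by force
  then have i1': "i1 = length xs - 1" using i1 by simp
  \<comment> \<open>List positions count from 0, the partition points of \<open>IE_set\<close> from
    1. The constant \<open>c i\<close> is sampled at the right end of its piece, which belongs to
    the piece.\<close>
  define x where "x i = xs ! (i - 1)" for i
  define c where "c i = f (x (Suc i)) - x (Suc i)" for i
  have "unit_restrict f \<in> Bij {0..1}" "unit_restrict f 0 = 0"
    using unit_restrict_Bij[OF f] iet_unit(2)[OF f] by (auto simp: unit_restrict_def)
  moreover have "2 \<le> length xs"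
  proof (rule ccontr)
    assume "\<not> ?thesis"
    then have "i0 = i1" using i0 i1 by linarith
    then show False using i0 i1 by simp
  qed
  moreover have "x 1 = 0" using i0 \<open>i0 = 0\<close> by (simp add: x_def)
  moreover have "x (length xs) = 1" using i1 i1' by (simp add: x_def)
  moreover have "x i \<in> \<Gamma>" if "i \<in> {1..length xs}" for i
    using unit(3)[of "i - 1"] that by (auto simp: x_def)
  moreover have "x i < x (Suc i) \<and> c i \<in> \<Gamma> \<and> (\<forall>t\<in>{x i<..x (Suc i)}. unit_restrict f t = t + c i)"
    if i: "i \<in> {1..<length xs}" for i
  proof (intro conjI ballI)
    show "x i < x (Suc i)" using sorted[of "i - 1" i] i by (auto simp: x_def)
    show "c i \<in> \<Gamma>" using f by (simp add: c_def iet_def)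
    fix t assume t: "t \<in> {x i<..x (Suc i)}"
    have "0 \<le> x i" "x (Suc i) \<le> 1" using unit(1)[of "i - 1"] unit(2)[of i] i by (auto simp: x_def)
    then have t01: "t \<in> {0..1}" using t by simp
    have "same_cell B (x (Suc i)) t"
      unfolding same_cell_def
    proof
      fix b assume b: "b \<in> B"
      have "b < t" if "b < x (Suc i)"
      proof (cases "b < 0")
        case True
        then show ?thesis using t01 by simp
      next
        case False
        then have "b \<in> set xs" unfolding set using b that unit(2)[of i] i by (auto simp: x_def)
        then obtain k where k: "k < length xs" "xs ! k = b" by (auto simp: in_set_conv_nth)
        have "k < i" using that k sorted[of i k] by (cases k i rule: linorder_cases) (auto simp: x_def)
        then have "b \<le> x i" using k sorted[of k "i - 1"] \<open>k < i\<close> i by (cases "k = i - 1") (fastforce simp: x_def)+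
        then show ?thesis using t by simp
      qed
      then show "b < x (Suc i) \<longleftrightarrow> b < t" using t by auto
    qed
    from pwD[OF B(3) this] show "unit_restrict f t = t + c i"
      using t01 by (simp add: unit_restrict_def c_def)
  qed
  ultimately show ?thesis
    unfolding IE_set_def by blast
qed

lemma IE_set_subset_image:
  assumes \<Gamma>: "subgroup \<Gamma> real_group" and "1 \<in> \<Gamma>" and F: "F \<in> IE_set \<Gamma>"
  shows "F \<in> unit_restrict ` iet \<Gamma>"
proof -
  from F obtain n :: nat and x c where FB: "F \<in> Bij {0..1}" and F0: "F 0 = 0" and n: "2 \<le> n"
    and x: "x 1 = 0" "x n = 1" "\<And>i. i \<in> {1..n} \<Longrightarrow> x i \<in> \<Gamma>"
    and c: "\<And>i. i \<in> {1..<n} \<Longrightarrow> x i < x (Suc i) \<and> c i \<in> \<Gamma>"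
    and Fc: "\<And>i t. i \<in> {1..<n} \<Longrightarrow> t \<in> {x i<..x (Suc i)} \<Longrightarrow> F t = t + c i"
    unfolding IE_set_def by blast
  define f where "f t = (if t \<in> {0<..1} then F t else t)" for t
  define B where "B = x ` {1..n}"
  have B: "finite B" "B \<subseteq> \<Gamma>" "0 \<in> B" "1 \<in> B"
    using x n by (auto simp: B_def image_iff intro: bexI[of _ 1] bexI[of _ n])
  have cell: "\<exists>i\<in>{1..<n}. t \<in> {x i<..x (Suc i)}" if t: "t \<in> {0<..1}" for t
  proof -
    \<comment> \<open>Minimality gives \<open>x j < t\<close>, and \<open>j\<close> is not 0 because
      \<open>x 1 = 0\<close> lies below \<open>t\<close>.\<close>
    define j where "j = (LEAST j. t \<le> x (Suc j))"
    have ex: "t \<le> x (Suc (n - 1))" using t x n by simp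
    have j: "t \<le> x (Suc j)" unfolding j_def by (rule LeastI[of "\<lambda>j. t \<le> x (Suc j)", OF ex])
    have "j \<le> n - 1" unfolding j_def by (rule Least_le[of "\<lambda>j. t \<le> x (Suc j)", OF ex])
    moreover have "j \<noteq> 0" using j t x by (intro notI) simp
    moreover from this have "\<not> t \<le> x (Suc (j - 1))"
      using not_less_Least[of "j - 1" "\<lambda>j. t \<le> x (Suc j)"] by (simp add: j_def)
    ultimately show ?thesis using j n by (intro bexI[of _ j]) auto
  qed
  have "bij_betw F {0..1} {0..1}" using FB by (simp add: Bij_def)
  \<comment> \<open>Removing the fixed point 0 leaves a bijection of (0, 1], which can be extended
    by the identity.\<close>
  from bij_betw_DiffI[OF this, of "{0}" "{0}"] F0 have "bij_betw F ({0..1} - {0}) ({0..1} - {0})" by simp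
  moreover have "{0..1} - {0} = {0<..1::real}" by auto
  ultimately have "bij_betw F {0<..1} {0<..1}" by simp
  moreover have "bij_betw F {0<..1} {0<..1} \<longleftrightarrow> bij_betw f {0<..1} {0<..1}"
    by (rule bij_betw_cong) (simp add: f_def)
  ultimately have "bij_betw f {0<..1} {0<..1}" by simp
  then have perm: "f permutes {0<..1}" by (rule bij_imp_permutes) (auto simp: f_def)
  have shift: "f t - t \<in> \<Gamma>" for t
  proof (cases "t \<in> {0<..1}")
    case True
    from cell[OF this] True Fc c show ?thesis by (auto simp: f_def)
  next
    case False
    then have "f t = t" unfolding f_def by (rule if_not_P)
    then show ?thesis using real_subgroup_zero[OF \<Gamma>] by simp
  qed
  have "piecewise_translation B f"
    unfolding piecewise_translation_def
  proof (intro allI impI)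
    fix s t assume st: "same_cell B s t"
    then have iff: "0 < s \<longleftrightarrow> 0 < t" "1 < s \<longleftrightarrow> 1 < t" using B by (auto simp: same_cell_def)
    show "f s - s = f t - t"
    proof (cases "s \<in> {0<..1}")
      case True
      then have t: "t \<in> {0<..1}" using iff by auto
      obtain i where i: "i \<in> {1..<n}" "s \<in> {x i<..x (Suc i)}" using cell[OF True] by blast
      then have "x i \<in> B" "x (Suc i) \<in> B" by (auto simp: B_def)
      then have "t \<in> {x i<..x (Suc i)}" using st i(2) by (auto simp: same_cell_def not_less[symmetric])
      then show ?thesis using Fc[OF i] Fc[OF i(1)] True t by (simp add: f_def)
    next
      case False
      then show ?thesis using iff by (auto simp: f_def)
    qed
  qed
  then have "f \<in> iet \<Gamma>" using perm shift B by (auto simp: iet_def)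
  moreover have "unit_restrict f = F"
    using FB F0 by (auto simp: unit_restrict_def f_def fun_eq_iff Bij_def extensional_def)
  ultimately show ?thesis by blast
qed

lemma IE_set_eq: "subgroup \<Gamma> real_group \<Longrightarrow> 1 \<in> \<Gamma> \<Longrightarrow> IE_set \<Gamma> = unit_restrict ` iet \<Gamma>"
  using IE_set_subset_image unit_restrict_in_IE by blast

lemma unit_restrict_hom:
  assumes \<Gamma>: "subgroup \<Gamma> real_group"
  shows "group_hom (real_perms\<lparr>carrier := iet \<Gamma>\<rparr>) (BijGroup {0..1}) unit_restrict"
proof (intro group_hom.intro group_hom_axioms.intro homI)
  show "group (real_perms\<lparr>carrier := iet \<Gamma>\<rparr>)"
    by (rule real_perms.subgroup_imp_group[OF iet_subgroup[OF \<Gamma>]])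
  show "group (BijGroup {0..1::real})" by (rule group_BijGroup)
  fix f assume f: "f \<in> carrier (real_perms\<lparr>carrier := iet \<Gamma>\<rparr>)"
  then show "unit_restrict f \<in> carrier (BijGroup {0..1})"
    by (simp add: BijGroup_def unit_restrict_Bij)
  fix g assume g: "g \<in> carrier (real_perms\<lparr>carrier := iet \<Gamma>\<rparr>)"
  have "g t \<in> {0..1}" if "t \<in> {0..1}" for t
    using iet_unit(1)[of g \<Gamma>] g that by (auto simp: bij_betw_def)
  then show "unit_restrict (f \<otimes>\<^bsub>real_perms\<lparr>carrier := iet \<Gamma>\<rparr>\<^esub> g) =
      unit_restrict f \<otimes>\<^bsub>BijGroup {0..1}\<^esub> unit_restrict g"
    using f g unit_restrict_Bij[of _ \<Gamma>]
    by (auto simp: BijGroup_def unit_restrict_def compose_def fun_eq_iff restrict_def)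
qed

text \<open>Restriction is an injective homomorphism, so generating sets correspond. Used for
  \<open>L\<close> the whole of \<open>iet \<Gamma>\<close> and for
  \<open>L = cyc_group \<Gamma>\<close>, which yield \<open>IE \<Gamma>\<close> and its derived
  subgroup.\<close>

lemma fin_gen_image_iff:
  assumes \<Gamma>: "subgroup \<Gamma> real_group" and L: "perm_subgroup L" "L \<subseteq> iet \<Gamma>"
  shows "fin_gen_group ((BijGroup {0..1})\<lparr>carrier := unit_restrict ` L\<rparr>) \<longleftrightarrow>
    (\<exists>S. finite S \<and> generate real_perms S = L)"
proof -
  interpret h: group_hom "real_perms\<lparr>carrier := iet \<Gamma>\<rparr>" "BijGroup {0..1}" unit_restrict
    by (rule unit_restrict_hom[OF \<Gamma>])
  have "subgroup L (real_perms\<lparr>carrier := iet \<Gamma>\<rparr>)"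
    by (rule real_perms.subgroup_incl[OF L(1) iet_subgroup[OF \<Gamma>] L(2)])
  note img = h.subgroup_img_is_subgroup[OF this]
  have gen: "generate (BijGroup {0..1}\<lparr>carrier := unit_restrict ` L\<rparr>) (unit_restrict ` S) =
    unit_restrict ` generate real_perms S" if "S \<subseteq> L" for S
  proof -
    have "generate (BijGroup {0..1}\<lparr>carrier := unit_restrict ` L\<rparr>) (unit_restrict ` S) =
        generate (BijGroup {0..1}) (unit_restrict ` S)"
      using that by (intro h.H.generate_consistent[OF _ img]) blast
    also have "\<dots> = unit_restrict ` generate (real_perms\<lparr>carrier := iet \<Gamma>\<rparr>) S"
      using that L(2) by (intro h.generate_img) auto
    also have "generate (real_perms\<lparr>carrier := iet \<Gamma>\<rparr>) S = generate real_perms S"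
      using that L(2) by (intro real_perms.generate_consistent[OF _ iet_subgroup[OF \<Gamma>]]) auto
    finally show ?thesis .
  qed
  have eq: "unit_restrict ` generate real_perms S = unit_restrict ` L \<longleftrightarrow> generate real_perms S = L"
    if "S \<subseteq> L" for S
    using inj_on_image_eq_iff[OF inj_on_unit_restrict, of "generate real_perms S" \<Gamma> L] L(2)
      real_perms.generate_subgroup_incl[OF that L(1)] by auto
  show ?thesis
  proof
    assume "fin_gen_group (BijGroup {0..1}\<lparr>carrier := unit_restrict ` L\<rparr>)"
    then obtain S' where S': "finite S'" "S' \<subseteq> unit_restrict ` L"
      "generate (BijGroup {0..1}\<lparr>carrier := unit_restrict ` L\<rparr>) S' = unit_restrict ` L"
      by (auto simp: fin_gen_group_def)
    then obtain S where "finite S" "S \<subseteq> L" "S' = unit_restrict ` S"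
      using finite_subset_image by metis
    then show "\<exists>S. finite S \<and> generate real_perms S = L" using S'(3) gen eq by auto
  next
    assume "\<exists>S. finite S \<and> generate real_perms S = L"
    then obtain S where S: "finite S" "generate real_perms S = L" by blast
    then have "S \<subseteq> L" using generate.incl[of _ S real_perms] by blast
    then show "fin_gen_group (BijGroup {0..1}\<lparr>carrier := unit_restrict ` L\<rparr>)"
      unfolding fin_gen_group_def using S gen by (intro exI[of _ "unit_restrict ` S"]) auto
  qed
qed

lemma derived_IE:
  assumes \<Gamma>: "subgroup \<Gamma> real_group" and "1 \<in> \<Gamma>"
  shows "derived_group (IE \<Gamma>) =
    (BijGroup {0..1})\<lparr>carrier := unit_restrict ` derived real_perms (iet \<Gamma>)\<rparr>"
proof -
  interpret h: group_hom "real_perms\<lparr>carrier := iet \<Gamma>\<rparr>" "BijGroup {0..1}" unit_restrict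
    by (rule unit_restrict_hom[OF \<Gamma>])
  have IE: "IE_set \<Gamma> = unit_restrict ` iet \<Gamma>" using assms by (rule IE_set_eq)
  have img: "subgroup (unit_restrict ` iet \<Gamma>) (BijGroup {0..1})" using h.img_is_subgroup by simp
  have "derived (BijGroup {0..1}\<lparr>carrier := unit_restrict ` iet \<Gamma>\<rparr>) (unit_restrict ` iet \<Gamma>) =
      derived (BijGroup {0..1}) (unit_restrict ` iet \<Gamma>)"
    by (rule h.H.derived_consistent[OF order_refl img])
  also have "\<dots> = unit_restrict ` derived (real_perms\<lparr>carrier := iet \<Gamma>\<rparr>) (iet \<Gamma>)"
    by (rule h.derived_img) simp
  also have "derived (real_perms\<lparr>carrier := iet \<Gamma>\<rparr>) (iet \<Gamma>) = derived real_perms (iet \<Gamma>)"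
    by (rule real_perms.derived_consistent[OF order_refl iet_subgroup[OF \<Gamma>]])
  finally show ?thesis by (simp add: derived_group_def IE_def IE)
qed

lemma fin_gen_real_iff:
  assumes \<Gamma>: "subgroup \<Gamma> real_group"
  shows "fin_gen_group (real_group\<lparr>carrier := \<Gamma>\<rparr>) \<longleftrightarrow> (\<exists>T. finite T \<and> generate real_group T = \<Gamma>)"
proof -
  have sub: "T \<subseteq> \<Gamma>" if "generate real_group T = \<Gamma>" for T
    using that generate.incl[of _ T real_group] by blast
  have "generate (real_group\<lparr>carrier := \<Gamma>\<rparr>) T = generate real_group T" if "T \<subseteq> \<Gamma>" for T
    by (rule real_group.generate_consistent[OF that \<Gamma>])
  then have "fin_gen_group (real_group\<lparr>carrier := \<Gamma>\<rparr>) \<longleftrightarrow>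
      (\<exists>T. finite T \<and> T \<subseteq> \<Gamma> \<and> generate real_group T = \<Gamma>)"
    by (simp add: fin_gen_group_def cong: conj_cong)
  then show ?thesis using sub by blast
qed

theorem theorem8:
  fixes \<Gamma> :: "real set"
  assumes "subgroup \<Gamma> real_group"
    and "countable \<Gamma>"
    and "closure \<Gamma> = UNIV"
    and "1 \<in> \<Gamma>"
  shows "(fin_gen_group (real_group\<lparr>carrier := \<Gamma>\<rparr>) \<longleftrightarrow> fin_gen_group (derived_group (IE \<Gamma>)))
       \<and> (fin_gen_group (derived_group (IE \<Gamma>)) \<longleftrightarrow> fin_gen_group (IE \<Gamma>))"
proof -
  note \<Gamma> = assms(1) and dense = assms(3)
  obtain d where "d \<in> \<Gamma>" "0 < d" "d < 1 / 100" using dense_obtain[OF dense, of 0 "1 / 100"] by auto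
  then interpret small_element \<Gamma> d
    using assms by (intro small_element.intro) auto
  have cyc: "fin_gen_group (derived_group (IE \<Gamma>)) \<longleftrightarrow> (\<exists>W. finite W \<and> generate real_perms W = cyc_group \<Gamma>)"
    using fin_gen_image_iff[OF \<Gamma> cyc_group_subgroup cyc_group_subset_iet[OF \<Gamma>]]
    by (simp add: derived_IE[OF \<Gamma> \<open>1 \<in> \<Gamma>\<close>] derived_iet)
  have iet: "fin_gen_group (IE \<Gamma>) \<longleftrightarrow> (\<exists>W. finite W \<and> generate real_perms W = iet \<Gamma>)"
    using fin_gen_image_iff[OF \<Gamma> iet_subgroup[OF \<Gamma>] order_refl]
    by (simp add: IE_def IE_set_eq[OF \<Gamma> \<open>1 \<in> \<Gamma>\<close>])
  have to: "\<exists>T. finite T \<and> generate real_group T = \<Gamma>"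
    if "finite W" "generate real_perms W = K" "cyc_group \<Gamma> \<subseteq> K" "K \<subseteq> iet \<Gamma>" for W K
  proof (rule finitely_many_shifts_generate[OF \<Gamma> dense \<open>finite W\<close>])
    show "W \<subseteq> iet \<Gamma>" using that generate.incl[of _ W real_perms] by blast
  qed (use that in simp)
  have converse: "(\<exists>W. finite W \<and> generate real_perms W = cyc_group \<Gamma>) \<and>
      (\<exists>W. finite W \<and> generate real_perms W = iet \<Gamma>)"
    if "finite T" "generate real_group T = \<Gamma>" for T
  proof -
    note T = that
    \<comment> \<open>\<open>S\<close> moves positions: above 1/8 its elements exceed
      \<open>2 * d\<close>, as \<open>d\<close> is at most 1/100, and below 1/4 they allow walks in
      [0, 1 - d]. \<open>S'\<close> changes rotation lengths and must allow walks in [0, d].\<close>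
    obtain S where S: "finite S" "generate real_group S = \<Gamma>" "S \<subseteq> {1 / 8<..<1 / 4}"
      by (rule generators_in_interval[OF \<Gamma> dense T, of "1 / 8" "1 / 4"]) simp_all
    obtain S' where S': "finite S'" "generate real_group S' = \<Gamma>" "S' \<subseteq> {0<..<d / 2}"
      by (rule generators_in_interval[OF \<Gamma> dense T, of 0 "d / 2"]) (use d_pos in simp_all)
    have S_bounds: "0 \<le> s" "2 * d \<le> s \<and> 4 * s \<le> 1" if "s \<in> S" for s
    proof -
      have "1 / 8 < s" "s < 1 / 4" using subsetD[OF S(3) that] by auto
      then show "0 \<le> s" "2 * d \<le> s \<and> 4 * s \<le> 1" using d_small by auto
    qed
    have S'_bounds: "0 \<le> s \<and> 2 * s \<le> d" if "s \<in> S'" for s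
      using subsetD[OF S'(3) that] by simp
    define W where "W = base_cycles \<union> window_cycles S"
    have "finite W"
      unfolding W_def by (intro finite_UnI finite_base_cycles finite_window_cycles S(1) S_bounds(1))
    moreover have W: "generate real_perms W = cyc_group \<Gamma>"
      unfolding W_def by (rule cyc_group_eq_generate[OF S(2) S_bounds(2)])
    moreover have "generate real_perms (W \<union> rot_gens S') = iet \<Gamma>"
      by (rule iet_eq_generate[OF W S'(2) S'_bounds])
    moreover have "finite (rot_gens S')" by (rule finite_rot_gens[OF S'(1)])
    ultimately show ?thesis by (meson finite_UnI)
  qed
  have "fin_gen_group (derived_group (IE \<Gamma>)) \<longleftrightarrow> (\<exists>T. finite T \<and> generate real_group T = \<Gamma>)"
    using cyc to[OF _ _ order_refl cyc_group_subset_iet[OF \<Gamma>]] converse by blast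
  moreover have "fin_gen_group (IE \<Gamma>) \<longleftrightarrow> (\<exists>T. finite T \<and> generate real_group T = \<Gamma>)"
    using iet to[OF _ _ cyc_group_subset_iet[OF \<Gamma>] order_refl] converse by blast
  ultimately show ?thesis using fin_gen_real_iff[OF \<Gamma>] by blast
qed

end
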